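(* Let $k \geq 2$, let $n$ and $t$ be integers with $1 \leq t \leq n$, let $T=[t]$, and let $u$ be a non-negative real number such that $u > \frac{6-t}{3}$. Let $\mathcal{H}_1, \dots, \mathcal{H}_k$ be non-empty compressed hereditary subfamilies of $2^{[n]}$. For each $l \in [k]$, let $w_l : \mathcal{H}_l \rightarrow \mathbb{R}^+$ be a function such that (a) $w_l(A) \geq (t+u)\,w_l(B)$ for every $A, B \in \mathcal{H}_l$ with $A \subsetneq B$ and $|A| \geq t$, and (b) $w_l(\delta_{i,j}(C)) \geq w_l(C)$ for every $C \in \mathcal{H}_l$ and every $i,j \in [n]$ with $i < j$. If $\mathcal{A}_l \subseteq \mathcal{H}_l$ for each $l \in [k]$, and $\mathcal{A}_1, \dots, \mathcal{A}_k$ are cross-$t$-intersecting, then \[\prod_{l=1}^k w_l(\mathcal{A}_l) \leq \prod_{l=1}^k w_l(\mathcal{H}_l(T)).\] Moreover, if $u > 0$ and each of $\mathcal{H}_1, \dots, \mathcal{H}_k$ has a member of size at least $t$, then the bound is attained if and only if for some $T' \in \binom{[n]}{t}$ such that $w_l(\mathcal{H}_l(T')) = w_l(\mathcal{H}_l(T))$ for each $l \in [k]$, $\mathcal{A}_l = \mathcal{H}_l(T')$ for each $l \in [k]$.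
   Context: $[n]=\{1,\dots,n\}$; $2^{[n]}$ is the family of all subsets of $[n]$; $\binom{[n]}{t}$ is the family of all $t$-element subsets of $[n]$; $\mathbb{R}^+$ is the set of positive real numbers. For a family $\mathcal{F}$ and a set $T$, $\mathcal{F}(T) = \{F \in \mathcal{F} : T \subseteq F\}$. For $i,j \in [n]$, $\delta_{i,j} : 2^{[n]} \to 2^{[n]}$ is defined by $\delta_{i,j}(A) = (A \setminus \{j\}) \cup \{i\}$ if $j \in A$ and $i \notin A$, and $\delta_{i,j}(A) = A$ otherwise. A family $\mathcal{F} \subseteq 2^{[n]}$ is compressed if $(F \setminus \{j\}) \cup \{i\} \in \mathcal{F}$ whenever $F \in \mathcal{F}$, $j \in F$, $i \in [n] \setminus F$ and $i < j$. A family is hereditary if it contains all subsets of each of its members. For a function $w : \mathcal{F} \to \mathbb{R}^+$ and $\mathcal{A} \subseteq \mathcal{F}$, $w(\mathcal{A}) = \sum_{A \in \mathcal{A}} w(A)$, which is $0$ if $\mathcal{A}$ is empty. Families $\mathcal{A}_1,\dots,\mathcal{A}_k$ (not necessarily distinct or non-empty) are cross-$t$-intersecting if for all $i,j \in [k]$ with $i \neq j$, $|A \cap B| \geq t$ for every $A \in \mathcal{A}_i$ and every $B \in \mathcal{A}_j$. *)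

theory Defs
  imports Complex_Main
begin

definition members_above :: "'a set set \<Rightarrow> 'a set \<Rightarrow> 'a set set" where
  "members_above \<F> T = {F \<in> \<F>. T \<subseteq> F}"

text \<open>The shift \<open>\<delta>\<^sub>i\<^sub>,\<^sub>j\<close>, which replaces \<open>j\<close> by \<open>i\<close> when possible.\<close>

definition shift :: "nat \<Rightarrow> nat \<Rightarrow> nat set \<Rightarrow> nat set" where
  "shift i j A = (if j \<in> A \<and> i \<notin> A then (A - {j}) \<union> {i} else A)"

text \<open>The requirement \<open>\<F> \<subseteq> Pow {1..n}\<close> is not part of this predicate.\<close>

definition compressed :: "nat \<Rightarrow> nat set set \<Rightarrow> bool" where
  "compressed n \<F> \<longleftrightarrow>
     (\<forall>F\<in>\<F>. \<forall>j\<in>F. \<forall>i\<in>{1..n} - F. i < j \<longrightarrow> (F - {j}) \<union> {i} \<in> \<F>)"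

definition hereditary :: "'a set set \<Rightarrow> bool" where
  "hereditary \<F> \<longleftrightarrow> (\<forall>F\<in>\<F>. \<forall>G. G \<subseteq> F \<longrightarrow> G \<in> \<F>)"

text \<open>As \<open>card\<close> is 0 on infinite sets, this has the intended meaning only for
  families of finite sets.\<close>

definition cross_t_intersecting :: "nat \<Rightarrow> nat \<Rightarrow> (nat \<Rightarrow> 'a set set) \<Rightarrow> bool" where
  "cross_t_intersecting t k \<A> \<longleftrightarrow>
     (\<forall>i\<in>{1..k}. \<forall>j\<in>{1..k}. i \<noteq> j \<longrightarrow>
        (\<forall>A\<in>\<A> i. \<forall>B\<in>\<A> j. t \<le> card (A \<inter> B)))"

end

theory Submission
  imports Defs
begin

text \<open>
  Write \<open>c = t + u\<close>.  Condition (a) says that removing a point from a set multiplies its weight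
  by at least \<open>c\<close>, as long as \<open>t\<close> points remain; condition (b) says that shifting never decreases
  a weight.  Inequalities for all pairs of families multiply up to the inequality for \<open>k\<close>
  families, with equality only if every pair has equality (\<open>prod_le_if_pairwise_le\<close>), so the
  work is in two families \<open>\<A> \<subseteq> G\<close> and \<open>\<B> \<subseteq> H\<close>.

  Choose a cross-\<open>t\<close>-intersecting pair with the largest product of weights and, among those, one
  that no shift can push further down; both families are then compressed.  Let \<open>p\<close> be least such
  that any \<open>A \<in> \<A>\<close>, \<open>B \<in> \<B>\<close> already meet in \<open>t\<close> points of \<open>{1..p}\<close>.  If \<open>p = t\<close>, all members
  contain \<open>{1..t}\<close> and the bound is clear.  If \<open>p > t\<close>, there are critical sets \<open>A\<close>, \<open>B\<close> whose
  intersection inside \<open>{1..p}\<close> has size exactly \<open>t\<close> and contains \<open>p\<close>.  Compression forces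
  \<open>A\<close> and \<open>B\<close> to cover \<open>{1..p}\<close>, so their traces on \<open>{1..p}\<close> have sizes \<open>a + b = p + t\<close>
  (\<open>critical_pair\<close>).  Three situations remain.

  If \<open>a = t\<close>, then every member of \<open>\<B>\<close> contains \<open>{1..p}\<close>.  The at most
  \<open>(p choose t) \<le> (1 + t) ^ (p - t)\<close> possible kernels of \<open>\<A>\<close> are outweighed by the factor
  \<open>(1 + c) ^ (p - t)\<close> lost by \<open>\<B>\<close> (\<open>dominated_full_trace\<close>).  The case \<open>b = t\<close> is symmetric.

  If \<open>a\<close> and \<open>b\<close> exceed \<open>t\<close> and \<open>p = t + 2\<close>, the possible traces on \<open>{1..t + 2}\<close> are few enough to
  be compared directly with those of the sets containing \<open>{1..t}\<close>
  (\<open>dominated_two_extra_points\<close>).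

  If \<open>a\<close> and \<open>b\<close> exceed \<open>t\<close> and \<open>p \<ge> t + 3\<close>, the critical sets of one family may be freed of the
  point \<open>p\<close> when those of the other family are discarded, and vice versa.  If neither of the two
  exchanges increases the product, the critical sets carry most of the weight on both sides.  But
  shifting \<open>p\<close> downwards bounds their shares by \<open>a / p\<close> and \<open>b / p\<close>.  Together this gives
  \<open>c \<le> 2 + 2 * t / (p - t) \<le> 2 + 2 * t / 3\<close>, contrary to \<open>u > (6 - t) / 3\<close>
  (\<open>swap_increases\<close>).

  If \<open>u > 0\<close>, the estimates of the first two situations are strict, so a compressed optimum consists
  of all members above \<open>{1..t}\<close>.  An arbitrary optimum is reached by undoing shifts one
  at a time, each of which can only move the kernel (\<open>kernel_before_shift\<close>).
\<close>

section \<open>Weight comparison along injections\<close>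

lemma sum_le_by_injection:
  fixes w :: "'a \<Rightarrow> real"
  assumes "finite Y" "inj_on f X" "f ` X \<subseteq> Y"
    and "\<And>x. x \<in> X \<Longrightarrow> k * w x \<le> w (f x)"
    and "\<And>y. y \<in> Y \<Longrightarrow> 0 \<le> w y"
  shows "k * sum w X \<le> sum w Y"
proof -
  have "k * sum w X = (\<Sum>x\<in>X. k * w x)" by (simp add: sum_distrib_left)
  also have "\<dots> \<le> (\<Sum>x\<in>X. w (f x))" by (intro sum_mono assms(4))
  also have "\<dots> = sum w (f ` X)" using assms(2) by (simp add: sum.reindex)
  also have "\<dots> \<le> sum w Y" using assms by (intro sum_mono2) auto
  finally show ?thesis .
qed

section \<open>Shifting a single set\<close>

lemma shift_eq: "j \<in> A \<Longrightarrow> i \<notin> A \<Longrightarrow> shift i j A = insert i (A - {j})"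
  by (auto simp: shift_def)

lemma shift_id: "j \<notin> A \<or> i \<in> A \<Longrightarrow> shift i j A = A"
  by (auto simp: shift_def)

lemma shift_subset: "A \<subseteq> X \<Longrightarrow> i \<in> X \<Longrightarrow> shift i j A \<subseteq> X"
  by (auto simp: shift_def)

lemma card_shift: "finite A \<Longrightarrow> card (shift i j A) = card A"
  by (cases "j \<in> A \<and> i \<notin> A") (auto simp: shift_eq shift_id card_Suc_Diff1 simp del: card_Diff_insert)

lemma inj_on_shift:
  assumes "\<And>A. A \<in> \<X> \<Longrightarrow> j \<in> A \<and> i \<notin> A"
  shows "inj_on (shift i j) \<X>"
proof (rule inj_on_inverseI)
  fix A assume "A \<in> \<X>"
  with assms have "j \<in> A" "i \<notin> A" by auto
  then show "insert j (shift i j A - {i}) = A" by (auto simp: shift_eq)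
qed

lemma sum_shift_less:
  fixes i j :: nat
  assumes "finite A" "i < j" "shift i j A \<noteq> A"
  shows "\<Sum> (shift i j A) < \<Sum> A"
proof -
  have *: "j \<in> A" "i \<notin> A" using assms(3) shift_id by blast+
  have "\<Sum> A = j + \<Sum> (A - {j})" using assms(1) * by (simp add: sum.remove)
  moreover have "\<Sum> (shift i j A) = i + \<Sum> (A - {j})"
    using assms(1) * by (simp add: shift_eq)
  ultimately show ?thesis using assms(2) by simp
qed

section \<open>Weights on one compressed hereditary family\<close>

text \<open>The parameter \<open>c\<close> stands for \<open>t + u\<close>; its two lower bounds then translate \<open>u \<ge> 0\<close> and
  \<open>u > (6 - t) / 3\<close>.\<close>

locale weighted_family =
  fixes n t :: nat and c :: real and H :: "nat set set" and w :: "nat set \<Rightarrow> real"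
  assumes t_pos: "1 \<le> t"
    and ground: "H \<subseteq> Pow {1..n}"
    and compr: "compressed n H" and hered: "hereditary H"
    and w_pos: "A \<in> H \<Longrightarrow> 0 < w A"
    and w_drop: "A \<in> H \<Longrightarrow> B \<in> H \<Longrightarrow> A \<subset> B \<Longrightarrow> t \<le> card A \<Longrightarrow> c * w B \<le> w A"
    and w_shift: "C \<in> H \<Longrightarrow> i \<in> {1..n} \<Longrightarrow> j \<in> {1..n} \<Longrightarrow> i < j \<Longrightarrow> w C \<le> w (shift i j C)"
    and c_ge: "real t \<le> c" and c_gt: "2 + 2 * real t / 3 < c"
begin

lemma finite_H: "finite H"
  using ground finite_subset by blast

lemma finite_member: "A \<in> H \<Longrightarrow> finite A"
  using ground finite_subset by blast

lemma finite_subfamily: "\<X> \<subseteq> H \<Longrightarrow> finite \<X>"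
  using finite_H finite_subset by blast

lemma subset_mem: "A \<in> H \<Longrightarrow> B \<subseteq> A \<Longrightarrow> B \<in> H"
  using hered unfolding hereditary_def by blast

lemma Diff_mem: "A \<in> H \<Longrightarrow> A - X \<in> H"
  by (rule subset_mem) auto

lemma shift_mem:
  assumes "A \<in> H" "i \<in> {1..n}" "i < j" shows "shift i j A \<in> H"
proof (cases "j \<in> A \<and> i \<notin> A")
  case True
  then have "A - {j} \<union> {i} \<in> H" using compr assms unfolding compressed_def by blast
  then show ?thesis using True by (simp add: shift_def)
qed (use assms in \<open>auto simp: shift_id\<close>)

lemma above_subset: "members_above H S \<subseteq> H"
  by (auto simp: members_above_def)

lemma weight_nonneg: "\<X> \<subseteq> H \<Longrightarrow> 0 \<le> sum w \<X>"
  by (intro sum_nonneg) (use w_pos less_imp_le in blast)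

lemma weight_mono: "\<X> \<subseteq> \<Y> \<Longrightarrow> \<Y> \<subseteq> H \<Longrightarrow> sum w \<X> \<le> sum w \<Y>"
  by (intro sum_mono2) (use finite_subfamily w_pos less_imp_le in blast)+

lemma weight_pos: "\<X> \<subseteq> H \<Longrightarrow> A \<in> \<X> \<Longrightarrow> 0 < sum w \<X>"
  by (intro sum_pos) (use finite_subfamily w_pos in blast)+

lemma weight_eqD:
  assumes "\<X> \<subseteq> \<Y>" "\<Y> \<subseteq> H" "sum w \<Y> \<le> sum w \<X>" shows "\<X> = \<Y>"
proof (rule ccontr)
  assume "\<X> \<noteq> \<Y>"
  then obtain A where A: "A \<in> \<Y> - \<X>" using assms(1) by blast
  have "sum w \<Y> = sum w (\<Y> - \<X>) + sum w \<X>"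
    using assms finite_subfamily by (metis sum.subset_diff)
  moreover have "0 < sum w (\<Y> - \<X>)" using weight_pos[of "\<Y> - \<X>" A] A assms(2) by blast
  ultimately show False using assms(3) by simp
qed

lemma weight_inj:
  assumes "\<Y> \<subseteq> H" "inj_on f \<X>" "f ` \<X> \<subseteq> \<Y>" "\<And>A. A \<in> \<X> \<Longrightarrow> k * w A \<le> w (f A)"
  shows "k * sum w \<X> \<le> sum w \<Y>"
proof (rule sum_le_by_injection[where f = f])
  show "finite \<Y>" using assms(1) finite_subfamily by blast
  show "\<And>A. A \<in> \<Y> \<Longrightarrow> 0 \<le> w A" using assms(1) w_pos less_imp_le by blast
qed (use assms in auto)

lemma weight_Un_le:
  assumes "\<X> \<subseteq> H" "\<Y> \<subseteq> H"
  shows "sum w (\<X> \<union> \<Y>) \<le> sum w \<X> + sum w \<Y>"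
proof -
  have "sum w (\<X> \<union> \<Y>) = sum w \<X> + sum w \<Y> - sum w (\<X> \<inter> \<Y>)"
    using assms finite_subfamily by (intro sum_Un) auto
  moreover have "0 \<le> sum w (\<X> \<inter> \<Y>)" using assms by (intro weight_nonneg) auto
  ultimately show ?thesis by simp
qed

lemma weight_UN_le:
  assumes "finite I" "\<And>i. i \<in> I \<Longrightarrow> F i \<subseteq> H"
  shows "sum w (\<Union>i\<in>I. F i) \<le> (\<Sum>i\<in>I. sum w (F i))"
  using assms
proof (induction I rule: finite_induct)
  case (insert i I)
  have "sum w (\<Union>i\<in>insert i I. F i) \<le> sum w (F i) + sum w (\<Union>i\<in>I. F i)"
    using weight_Un_le[of "F i" "\<Union>i\<in>I. F i"] insert.prems by auto
  also have "\<dots> \<le> sum w (F i) + (\<Sum>i\<in>I. sum w (F i))" using insert by simp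
  finally show ?case using insert.hyps by simp
qed simp

text \<open>The shift itself embeds the members above \<open>S\<close> into the members above the shifted \<open>S\<close>: a member
  that already contains \<open>i\<close> stays put and keeps \<open>j\<close>, while a moved member loses \<open>j\<close>, so no two
  images coincide.\<close>

lemma weight_above_shift:
  assumes "i \<in> {1..n}" "j \<in> {1..n}" "i < j" "j \<in> S" "i \<notin> S"
  shows "sum w (members_above H S) \<le> sum w (members_above H (shift i j S))"
proof -
  have "1 * sum w (members_above H S) \<le> sum w (members_above H (shift i j S))"
  proof (rule weight_inj[OF above_subset])
    show "inj_on (shift i j) (members_above H S)"
      using assms by (auto simp: inj_on_def members_above_def shift_def)
    show "shift i j ` members_above H S \<subseteq> members_above H (shift i j S)"
    proof
      fix A assume "A \<in> shift i j ` members_above H S"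
      then obtain B where B: "A = shift i j B" "B \<in> H" "S \<subseteq> B"
        by (auto simp: members_above_def)
      have "shift i j S \<subseteq> A" using B(1,3) assms by (auto simp: shift_def)
      then show "A \<in> members_above H (shift i j S)"
        using B shift_mem assms by (auto simp: members_above_def)
    qed
  qed (use w_shift assms in \<open>auto simp: members_above_def\<close>)
  then show ?thesis by simp
qed

text \<open>As long as \<open>S\<close> is not an initial segment, one of its points can be replaced by a smaller one,
  which does not decrease the weight above it.\<close>

lemma weight_above_initial:
  assumes "S \<subseteq> {1..n}"
  shows "sum w (members_above H S) \<le> sum w (members_above H {1..card S})"
  using assms
proof (induction "\<Sum> S" arbitrary: S rule: less_induct)
  case less
  have fin: "finite S" using less.prems finite_subset by blast
  show ?case
  proof (cases "S = {1..card S}")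
    case False
    have "\<not> {1..card S} \<subseteq> S"
    proof
      assume "{1..card S} \<subseteq> S"
      from card_subset_eq[OF fin this] show False using False by simp
    qed
    then obtain i where i: "i \<in> {1..card S}" "i \<notin> S" by blast
    have "\<not> S \<subseteq> {1..card S} - {i}"
    proof
      assume "S \<subseteq> {1..card S} - {i}"
      then have "card S \<le> card ({1..card S} - {i})" by (intro card_mono) auto
      then show False using i(1) by auto
    qed
    then obtain j where j: "j \<in> S" "j \<notin> {1..card S}" using i by blast
    have "card S \<le> n" using card_mono[OF _ less.prems] by simp
    moreover have "j \<in> {1..n}" using j less.prems by blast
    ultimately have ij: "i \<in> {1..n}" "j \<in> {1..n}" "i < j" using i j by auto
    have "sum w (members_above H S) \<le> sum w (members_above H (shift i j S))"
      using weight_above_shift ij i j by blast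
    also have "\<dots> \<le> sum w (members_above H {1..card (shift i j S)})"
    proof (rule less.hyps)
      show "\<Sum> (shift i j S) < \<Sum> S"
        using sum_shift_less[OF fin ij(3)] i j by (auto simp: shift_def)
      show "shift i j S \<subseteq> {1..n}" using shift_subset less.prems ij by blast
    qed
    finally show ?thesis using fin by (simp add: card_shift)
  next
    case True
    show ?thesis
      by (rule eq_refl[OF arg_cong[OF True, where f = "\<lambda>S. sum w (members_above H S)"]])
  qed
qed

text \<open>Membership comes out of the weight comparison: the members above \<open>{1..t}\<close> weigh at least as
  much as those above a \<open>t\<close>-subset of \<open>A\<close>, so there are some.\<close>

lemma initial_mem:
  assumes "A \<in> H" "t \<le> card A" shows "{1..t} \<in> H"
proof -
  obtain S where S: "S \<subseteq> A" "card S = t" using assms(2) by (meson obtain_subset_with_card_n)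
  have "S \<in> members_above H S" using S assms(1) by (auto simp: members_above_def intro: subset_mem)
  then have "0 < sum w (members_above H {1..t})"
  proof -
    have "S \<subseteq> {1..n}" using S assms(1) ground by blast
    then show ?thesis
      using weight_above_initial[of S] weight_pos[OF above_subset \<open>S \<in> members_above H S\<close>] S by simp
  qed
  then have "members_above H {1..t} \<noteq> {}" by force
  then show ?thesis by (auto simp: members_above_def intro: subset_mem)
qed

lemma weight_initial_pos: "{1..t} \<in> H \<Longrightarrow> 0 < sum w (members_above H {1..t})"
  by (rule weight_pos[OF above_subset, of "{1..t}"]) (simp add: members_above_def)

lemma c_pos: "0 < c"
proof -
  have "0 \<le> real t" by simp
  then show ?thesis using c_gt by linarith
qed

text \<open>Deleting \<open>x\<close> embeds the members that contain \<open>x\<close> into those that do not, gaining the factor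
  \<open>c\<close>; the \<open>1\<close> accounts for the members that contain \<open>x\<close> themselves.\<close>

lemma weight_above_insert:
  assumes "t \<le> card S" "finite S" "x \<notin> S"
  shows "(1 + c) * sum w (members_above H (insert x S)) \<le> sum w (members_above H S)"
proof -
  let ?X = "members_above H (insert x S)"
  let ?Y = "{A \<in> members_above H S. x \<notin> A}"
  have "c * sum w ?X \<le> sum w ?Y"
  proof (rule weight_inj)
    show "?Y \<subseteq> H" by (auto simp: members_above_def)
    show "inj_on (\<lambda>A. A - {x}) ?X"
      by (rule inj_on_inverseI[where g = "insert x"]) (auto simp: members_above_def)
    show "(\<lambda>A. A - {x}) ` ?X \<subseteq> ?Y"
      using assms(3) Diff_mem by (auto simp: members_above_def)
    fix A assume A: "A \<in> ?X"
    then have "card S \<le> card (A - {x})"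
      using assms finite_member by (intro card_mono) (auto simp: members_above_def)
    then show "c * w A \<le> w (A - {x})"
      using A assms Diff_mem by (intro w_drop) (auto simp: members_above_def)
  qed
  moreover have "sum w (members_above H S) = sum w ?X + sum w ?Y"
  proof -
    have "finite ?X" "finite ?Y" using finite_H by (auto simp: members_above_def)
    moreover have "members_above H S = ?X \<union> ?Y" "?X \<inter> ?Y = {}" by (auto simp: members_above_def)
    ultimately show ?thesis by (metis sum.union_disjoint)
  qed
  ultimately show ?thesis by (simp add: algebra_simps)
qed

lemma weight_above_initial_power:
  "(1 + c) ^ d * sum w (members_above H {1..t + d}) \<le> sum w (members_above H {1..t})"
proof (induction d)
  case (Suc d)
  have e: "{1..t + Suc d} = insert (t + Suc d) {1..t + d}" by auto
  have "(1 + c) ^ Suc d * sum w (members_above H {1..t + Suc d})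
      = (1 + c) ^ d * ((1 + c) * sum w (members_above H {1..t + Suc d}))" by simp
  also have "\<dots> \<le> (1 + c) ^ d * sum w (members_above H {1..t + d})"
    unfolding e by (intro mult_left_mono weight_above_insert) (use c_pos in auto)
  finally show ?case using Suc.IH by simp
qed simp

text \<open>A set with at least \<open>t + 1\<close> of the first \<open>t + 2\<close> points either contains \<open>{1..t}\<close> or misses exactly
  one of these \<open>t + 2\<close> points, some \<open>i \<le> t\<close>.  The sets of the second kind weigh at most \<open>t\<close> times
  as much as those that miss only \<open>t + 1\<close> (shift \<open>t + 1\<close> to \<open>i\<close>), and deleting \<open>t + 2\<close> from the
  latter gives sets with trace \<open>{1..t}\<close>, which are above \<open>{1..t}\<close> but too small to be counted on
  the other side.\<close>

lemma weight_large_trace: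
  defines "P \<equiv> {1..t + 2}"
  defines "E0 \<equiv> {A \<in> H. A \<inter> P = {1..t}}" and "E1 \<equiv> {A \<in> H. A \<inter> P = P - {t + 1}}"
  shows "sum w {A \<in> H. t + 1 \<le> card (A \<inter> P)} + sum w E0
           \<le> sum w (members_above H {1..t}) + real t * sum w E1"
    and "c * sum w E1 \<le> sum w E0"
    and "(1 + c) * sum w E1 \<le> sum w (members_above H {1..t})"
proof -
  define E where "E i = {A \<in> H. A \<inter> P = P - {i}}" for i
  have P: "t + 1 \<in> P" "t + 2 \<in> P" "\<And>i. i \<in> {1..t} \<Longrightarrow> i \<in> P" "card P = t + 2" "finite P"
    by (auto simp: P_def)
  have PT: "P - {t + 1} - {t + 2} = {1..t}" "insert (t + 2) {1..t} = P - {t + 1}"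
    by (auto simp: P_def)
  have E1: "E1 = E (t + 1)" by (simp add: E_def E1_def)
  have fin: "finite \<X>" if "\<X> \<subseteq> H" for \<X> using that by (rule finite_subfamily)
  (* If no set misses only i, there is nothing to shift, and t + 1 may lie outside the ground set. *)
  have Ele: "sum w (E i) \<le> sum w E1" if i: "i \<in> {1..t}" for i
  proof (cases "E i = {}")
    case False
    then obtain A where "A \<in> H" "A \<inter> P = P - {i}" by (auto simp: E_def)
    moreover have "t + 2 \<in> P - {i}" using i P by simp
    ultimately have "t + 2 \<in> A" by blast
    then have "t + 2 \<in> {1..n}" using \<open>A \<in> H\<close> ground by blast
    then have ij: "i \<in> {1..n}" "t + 1 \<in> {1..n}" "i < t + 1" using i by auto
    have "1 * sum w (E i) \<le> sum w (E (t + 1))"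
    proof (rule weight_inj)
      show "E (t + 1) \<subseteq> H" by (auto simp: E_def)
      have *: "t + 1 \<in> A \<and> i \<notin> A" if "A \<in> E i" for A
      proof -
        have "A \<inter> P = P - {i}" "t + 1 \<in> P" "i \<in> P" "i \<noteq> t + 1"
          using that i P(1) P(3)[OF i] by (auto simp: E_def)
        then show ?thesis by blast
      qed
      show "inj_on (shift i (t + 1)) (E i)"
        using * by (rule inj_on_shift)
      show "shift i (t + 1) ` E i \<subseteq> E (t + 1)"
      proof
        fix B assume "B \<in> shift i (t + 1) ` E i"
        then obtain A where A: "A \<in> E i" "B = shift i (t + 1) A" by blast
        have "B = insert i (A - {t + 1})" using A * by (simp add: shift_eq)
        moreover have AP: "A \<inter> P = P - {i}" "i \<in> P" "i \<noteq> t + 1"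
          using A i P(3)[OF i] by (auto simp: E_def)
        ultimately have "B \<inter> P = insert i (A \<inter> P - {t + 1})" by auto
        also have "\<dots> = P - {t + 1}" using AP by auto
        finally have "B \<inter> P = P - {t + 1}" .
        moreover have "B \<in> H" using A shift_mem ij by (auto simp: E_def)
        ultimately show "B \<in> E (t + 1)" by (simp add: E_def)
      qed
      fix A assume "A \<in> E i"
      then show "1 * w A \<le> w (shift i (t + 1) A)" using w_shift ij by (auto simp: E_def)
    qed
    then show ?thesis by (simp add: E1)
  qed (use weight_nonneg[of E1] in \<open>auto simp: E1_def\<close>)
  show "c * sum w E1 \<le> sum w E0"
  proof (rule weight_inj)
    have mem: "t + 2 \<in> A" if "A \<in> E1" for A
    proof -
      have "t + 2 \<in> P - {t + 1}" using P(2) by simp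
      also have "P - {t + 1} = A \<inter> P" using that unfolding E1_def by blast
      finally show ?thesis by blast
    qed
    show "E0 \<subseteq> H" by (auto simp: E0_def)
    show "inj_on (\<lambda>A. A - {t + 2}) E1"
      by (rule inj_on_inverseI[where g = "insert (t + 2)"]) (use mem in blast)
    have *: "(A - {t + 2}) \<inter> P = {1..t}" if "A \<in> E1" for A
    proof -
      have "(A - {t + 2}) \<inter> P = P - {t + 1} - {t + 2}" using that unfolding E1_def by blast
      also note PT(1)
      finally show ?thesis .
    qed
    have E1_H: "A \<in> H" if "A \<in> E1" for A using that unfolding E1_def by blast
    show "(\<lambda>A. A - {t + 2}) ` E1 \<subseteq> E0"
      using * E1_H Diff_mem unfolding E0_def by blast
    fix A assume A: "A \<in> E1"
    have "card {1..t} \<le> card (A - {t + 2})"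
      using *[OF A] finite_member[OF E1_H[OF A]] by (intro card_mono) auto
    then show "c * w A \<le> w (A - {t + 2})"
      using E1_H[OF A] mem[OF A] Diff_mem by (intro w_drop) auto
  qed
  show "(1 + c) * sum w E1 \<le> sum w (members_above H {1..t})"
  proof -
    have "E1 \<subseteq> members_above H (insert (t + 2) {1..t})"
      unfolding PT(2) E1_def members_above_def by blast
    then have "(1 + c) * sum w E1 \<le> (1 + c) * sum w (members_above H (insert (t + 2) {1..t}))"
      using c_pos by (intro mult_left_mono weight_mono above_subset) auto
    also have "\<dots> \<le> sum w (members_above H {1..t})"
      by (rule weight_above_insert) auto
    finally show ?thesis .
  qed
  have sub: "{A \<in> H. t + 1 \<le> card (A \<inter> P)} \<subseteq> (members_above H {1..t} - E0) \<union> (\<Union>i\<in>{1..t}. E i)"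
  proof
    fix A assume A: "A \<in> {A \<in> H. t + 1 \<le> card (A \<inter> P)}"
    show "A \<in> (members_above H {1..t} - E0) \<union> (\<Union>i\<in>{1..t}. E i)"
    proof (cases "{1..t} \<subseteq> A")
      case True
      have "A \<notin> E0"
      proof
        assume "A \<in> E0"
        then have "card (A \<inter> P) = t" by (simp add: E0_def)
        then show False using A by simp
      qed
      then show ?thesis using A True unfolding members_above_def by blast
    next
      case False
      then obtain i where i: "i \<in> {1..t}" "i \<notin> A" by blast
      have "A \<inter> P = P - {i}"
      proof (rule card_subset_eq)
        show "card (A \<inter> P) = card (P - {i})"
        proof (rule antisym)
          show "card (A \<inter> P) \<le> card (P - {i})"
            using i P by (intro card_mono) auto
          show "card (P - {i}) \<le> card (A \<inter> P)" using A P(4) P(3)[OF i(1)] by simp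
        qed
      qed (use i P in auto)
      then have "A \<in> E i" using A by (simp add: E_def)
      then show ?thesis using i(1) by blast
    qed
  qed
  have subs: "E i \<subseteq> H" "members_above H {1..t} - E0 \<subseteq> H" "E0 \<subseteq> members_above H {1..t}" for i
    unfolding E_def E0_def members_above_def by blast+
  have "sum w {A \<in> H. t + 1 \<le> card (A \<inter> P)}
      \<le> sum w ((members_above H {1..t} - E0) \<union> (\<Union>i\<in>{1..t}. E i))"
    by (rule weight_mono[OF sub]) (use subs in blast)
  moreover have "\<dots> \<le> sum w (members_above H {1..t} - E0) + sum w (\<Union>i\<in>{1..t}. E i)"
    by (rule weight_Un_le) (use subs in blast)+
  moreover have "sum w (\<Union>i\<in>{1..t}. E i) \<le> (\<Sum>i\<in>{1..t}. sum w (E i))"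
    by (rule weight_UN_le) (use subs in auto)
  moreover have "(\<Sum>i\<in>{1..t}. sum w (E i)) \<le> real t * sum w E1"
    using sum_bounded_above[of "{1..t}" "\<lambda>i. sum w (E i)" "sum w E1"] Ele by simp
  moreover have "sum w (members_above H {1..t} - E0) = sum w (members_above H {1..t}) - sum w E0"
    by (rule sum_diff[OF fin[OF above_subset] subs(3)])
  ultimately show "sum w {A \<in> H. t + 1 \<le> card (A \<inter> P)} + sum w E0
           \<le> sum w (members_above H {1..t}) + real t * sum w E1" by linarith
qed

text \<open>The gain of an exchange: every set of \<open>\<S>\<close> contributes a new set that is \<open>c\<close> times as heavy.
  The bound \<open>t < card A\<close> leaves at least \<open>t\<close> points after the removal.\<close>

lemma weight_remove_point:
  assumes "\<A> \<subseteq> H" "\<S> \<subseteq> \<A>"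
    and "\<And>A. A \<in> \<S> \<Longrightarrow> p \<in> A \<and> t < card A \<and> A - {p} \<notin> \<A>"
  shows "(\<lambda>A. A - {p}) ` \<S> \<subseteq> H"
    and "sum w \<A> + c * sum w \<S> \<le> sum w (\<A> \<union> (\<lambda>A. A - {p}) ` \<S>)"
proof -
  let ?D = "(\<lambda>A. A - {p}) ` \<S>"
  show D: "?D \<subseteq> H" using assms(1,2) Diff_mem by blast
  have "c * sum w \<S> \<le> sum w ?D"
  proof (rule weight_inj[OF D])
    show "inj_on (\<lambda>A. A - {p}) \<S>"
      by (rule inj_on_inverseI[where g = "insert p"]) (use assms(3) in blast)
    fix A assume A: "A \<in> \<S>"
    have "A \<in> H" "p \<in> A" "t < card A" using A assms by auto
    moreover have "t \<le> card (A - {p})" using calculation by simp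
    ultimately show "c * w A \<le> w (A - {p})" by (intro w_drop Diff_mem) auto
  qed simp
  moreover have "sum w (\<A> \<union> ?D) = sum w \<A> + sum w ?D"
  proof (rule sum.union_disjoint)
    show "finite \<A>" "finite ?D" using assms(1) D finite_subfamily by auto
    show "\<A> \<inter> ?D = {}" using assms(3) by blast
  qed
  ultimately show "sum w \<A> + c * sum w \<S> \<le> sum w (\<A> \<union> ?D)" by linarith
qed

text \<open>Double counting.  A set of \<open>\<S>\<close> yields \<open>p - a\<close> sets of \<open>\<A>\<close> without \<open>p\<close> by moving \<open>p\<close> to any of its
  gaps below \<open>p\<close>, and none of them is lighter.  Conversely, a set without \<open>p\<close> and with trace of size
  \<open>a\<close> arises in at most \<open>a\<close> ways, once for each point that may have been \<open>p\<close>.  So \<open>\<S>\<close> has at most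
  the share \<open>a / p\<close> of the weight of \<open>\<A>\<close>.\<close>

lemma weight_containing_last:
  assumes "\<A> \<subseteq> H" "compressed n \<A>" "p \<le> n"
    and \<S>: "\<And>A. A \<in> \<S> \<Longrightarrow> A \<in> \<A> \<and> p \<in> A \<and> card (A \<inter> {1..p}) = a"
  shows "real p * sum w \<S> \<le> real a * sum w \<A>"
proof (cases "\<S> = {}")
  case False
  define \<D> where "\<D> = {A \<in> \<A>. p \<notin> A \<and> card (A \<inter> {1..p}) = a}"
  have sub: "\<S> \<subseteq> H" "\<D> \<subseteq> H" using \<S> assms(1) by (auto simp: \<D>_def)
  note fin = this[THEN finite_subfamily]
  have "a \<le> p"
  proof -
    obtain A where "A \<in> \<S>" using False by blast
    then have "a = card (A \<inter> {1..p})" using \<S> by simp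
    also have "\<dots> \<le> card {1..p}" by (intro card_mono) auto
    finally show ?thesis by simp
  qed
  have "(\<Sum>(A, i)\<in>Sigma \<S> (\<lambda>A. {1..p} - A). w A) = (\<Sum>A\<in>\<S>. real (p - a) * w A)"
  proof (subst sum.Sigma[symmetric])
    show "(\<Sum>A\<in>\<S>. \<Sum>i\<in>{1..p} - A. w A) = (\<Sum>A\<in>\<S>. real (p - a) * w A)"
    proof (rule sum.cong[OF refl])
      fix A assume "A \<in> \<S>"
      then have "card ({1..p} - A) = p - a"
        using \<S> by (subst card_Diff_subset_Int) (auto simp: Int_commute)
      then show "(\<Sum>i\<in>{1..p} - A. w A) = real (p - a) * w A" by simp
    qed
  qed (use fin in auto)
  moreover have "(\<Sum>(A, i)\<in>Sigma \<D> (\<lambda>A. A \<inter> {1..p}). w A) = (\<Sum>A\<in>\<D>. real a * w A)"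
    by (subst sum.Sigma[symmetric]) (use fin in \<open>auto simp: \<D>_def intro!: sum.cong\<close>)
  moreover have "1 * (\<Sum>(A, i)\<in>Sigma \<S> (\<lambda>A. {1..p} - A). w A)
      \<le> (\<Sum>(A, i)\<in>Sigma \<D> (\<lambda>A. A \<inter> {1..p}). w A)"
  proof (rule sum_le_by_injection[where f = "\<lambda>(A, i). (insert i (A - {p}), i)"])
    show "finite (Sigma \<D> (\<lambda>A. A \<inter> {1..p}))" using fin by auto
    show "inj_on (\<lambda>(A, i). (insert i (A - {p}), i)) (Sigma \<S> (\<lambda>A. {1..p} - A))"
      by (rule inj_on_inverseI[where g = "\<lambda>(B, i). (insert p (B - {i}), i)"]) (use \<S> in auto)
    have step: "shift i p A = insert i (A - {p})" "i \<in> {1..n}" "p \<in> {1..n}" "i < p"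
      "insert i (A - {p}) \<in> \<D>" if "A \<in> \<S>" "i \<in> {1..p} - A" for A i
    proof -
      have A: "A \<in> \<A>" "p \<in> A" "card (A \<inter> {1..p}) = a" "i \<notin> A" "i \<in> {1..p}" using that \<S> by auto
      show "shift i p A = insert i (A - {p})" using A by (simp add: shift_eq)
      have "i \<noteq> p" using A by auto
      then show i: "i \<in> {1..n}" "p \<in> {1..n}" "i < p" using A assms(3) by auto
      have "A - {p} \<union> {i} \<in> \<A>" using assms(2) A i unfolding compressed_def by blast
      moreover have "insert i (A - {p}) \<inter> {1..p} = insert i (A \<inter> {1..p} - {p})" using A by auto
      moreover have "card (insert i (A \<inter> {1..p} - {p})) = a"
        using A by (simp add: card_Suc_Diff1 del: card_Diff_insert)
      ultimately show "insert i (A - {p}) \<in> \<D>" using i by (simp add: \<D>_def)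
    qed
    show "(\<lambda>(A, i). (insert i (A - {p}), i)) ` Sigma \<S> (\<lambda>A. {1..p} - A)
        \<subseteq> Sigma \<D> (\<lambda>A. A \<inter> {1..p})"
      using step by auto
    show "1 * (case x of (A, i) \<Rightarrow> w A)
        \<le> (case case x of (A, i) \<Rightarrow> (insert i (A - {p}), i) of (A, i) \<Rightarrow> w A)"
      if "x \<in> Sigma \<S> (\<lambda>A. {1..p} - A)" for x
    proof -
      obtain A i where x: "x = (A, i)" "A \<in> \<S>" "i \<in> {1..p} - A" using \<open>x \<in> _\<close> by auto
      have "w A \<le> w (shift i p A)" using x sub step[OF x(2,3)] by (intro w_shift) auto
      then show ?thesis using x step(1)[OF x(2,3)] by simp
    qed
    show "0 \<le> (case y of (A, i) \<Rightarrow> w A)" if "y \<in> Sigma \<D> (\<lambda>A. A \<inter> {1..p})" for y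
    proof -
      obtain A i where "y = (A, i)" "A \<in> \<D>" using \<open>y \<in> _\<close> by auto
      then show ?thesis using sub(2) w_pos[of A] by auto
    qed
  qed
  ultimately have "real (p - a) * sum w \<S> \<le> real a * sum w \<D>"
    by (simp add: sum_distrib_left)
  moreover have "sum w \<S> + sum w \<D> \<le> sum w \<A>"
  proof -
    have "sum w \<S> + sum w \<D> = sum w (\<S> \<union> \<D>)"
      using fin \<S> by (intro sum.union_disjoint[symmetric]) (auto simp: \<D>_def)
    also have "\<dots> \<le> sum w \<A>" using \<S> assms(1) by (intro weight_mono) (auto simp: \<D>_def)
    finally show ?thesis .
  qed
  then have "real a * (sum w \<S> + sum w \<D>) \<le> real a * sum w \<A>" by (rule mult_left_mono) simp
  ultimately show ?thesis using \<open>a \<le> p\<close> by (simp add: of_nat_diff algebra_simps)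
qed (use weight_nonneg[OF assms(1)] in simp)

end

section \<open>Shifting two cross-intersecting families\<close>

definition cross :: "nat \<Rightarrow> nat set set \<Rightarrow> nat set set \<Rightarrow> bool" where
  "cross t \<A> \<B> \<longleftrightarrow> (\<forall>A\<in>\<A>. \<forall>B\<in>\<B>. t \<le> card (A \<inter> B))"

lemma cross_commute: "cross t \<A> \<B> \<longleftrightarrow> cross t \<B> \<A>"
  unfolding cross_def by (metis Int_commute)

text \<open>A set moves only if its shift is not occupied.  The compression of \<open>\<A>\<close> is thus the image of an
  injective map on \<open>\<A>\<close>, through which weights and element sums can be followed set by set.\<close>

definition shift_within :: "nat \<Rightarrow> nat \<Rightarrow> nat set set \<Rightarrow> nat set \<Rightarrow> nat set" where
  "shift_within i j \<A> A = (if shift i j A \<in> \<A> then A else shift i j A)"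

definition shift_family :: "nat \<Rightarrow> nat \<Rightarrow> nat set set \<Rightarrow> nat set set" where
  "shift_family i j \<A> = shift_within i j \<A> ` \<A>"

lemma inj_on_shift_within: "inj_on (shift_within i j \<A>) \<A>"
proof (rule inj_onI)
  fix A B assume AB: "A \<in> \<A>" "B \<in> \<A>" "shift_within i j \<A> A = shift_within i j \<A> B"
  show "A = B"
  proof (cases "shift i j A \<in> \<A> \<or> shift i j B \<in> \<A>")
    case True
    then show ?thesis using AB by (auto simp: shift_within_def split: if_splits)
  next
    case False
    then have "shift i j A \<noteq> A" "shift i j B \<noteq> B" using AB by auto
    then have "\<forall>C\<in>{A, B}. j \<in> C \<and> i \<notin> C" using shift_id by blast
    then have "inj_on (shift i j) {A, B}" by (intro inj_on_shift) blast
    moreover have "shift i j A = shift i j B" using AB(3) False by (simp add: shift_within_def)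
    ultimately show ?thesis by (auto dest: inj_onD)
  qed
qed

text \<open>When only \<open>A\<close> moves, the intersection can shrink only if \<open>B\<close> contains \<open>j\<close> and not \<open>i\<close>.  But then
  \<open>B\<close> stays because its shift is present as well, and \<open>A\<close> meets that shift in exactly the points in
  which the shift of \<open>A\<close> meets \<open>B\<close>.\<close>

lemma cross_shift_one_moved:
  assumes fin: "finite A" "finite B" and ij: "i \<noteq> j" and A: "j \<in> A" "i \<notin> A"
    and AB: "t \<le> card (A \<inter> B)" and AB': "t \<le> card (A \<inter> shift i j B)"
  shows "t \<le> card (shift i j A \<inter> B)"
proof -
  have A': "shift i j A = insert i (A - {j})" using A by (simp add: shift_eq)
  consider "j \<notin> B" | "i \<in> B" "j \<in> B" | "j \<in> B" "i \<notin> B" by blast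
  then show ?thesis
  proof cases
    case 1
    then have "A \<inter> B \<subseteq> shift i j A \<inter> B" using A' by auto
    then show ?thesis using AB card_mono[of "shift i j A \<inter> B" "A \<inter> B"] fin by simp
  next
    case 2
    then have "shift i j A \<inter> B = insert i (A \<inter> B - {j})" using A' ij by auto
    then have "card (shift i j A \<inter> B) = card (A \<inter> B)"
      using fin A 2 by (simp add: card_Suc_Diff1 del: card_Diff_insert)
    then show ?thesis using AB by simp
  next
    case 3
    then have "shift i j A \<inter> B = A \<inter> shift i j B" using A A' by (auto simp: shift_eq)
    then show ?thesis using AB' by simp
  qed
qed

lemma cross_shift_family:
  assumes cr: "cross t \<A> \<B>" and ij: "i \<noteq> j"
    and fin: "\<And>A. A \<in> \<A> \<Longrightarrow> finite A" "\<And>B. B \<in> \<B> \<Longrightarrow> finite B"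
  shows "cross t (shift_family i j \<A>) (shift_family i j \<B>)"
proof -
  have "t \<le> card (shift_within i j \<A> A \<inter> shift_within i j \<B> B)" if AB: "A \<in> \<A>" "B \<in> \<B>" for A B
  proof -
    have c: "t \<le> card (A \<inter> B)" using cr AB by (auto simp: cross_def)
    have moved: "j \<in> C \<and> i \<notin> C" if "shift i j C \<notin> \<X>" "C \<in> \<X>" for C \<X>
      using that shift_id by metis
    consider "shift i j A \<in> \<A>" "shift i j B \<in> \<B>"
      | "shift i j A \<in> \<A>" "shift i j B \<notin> \<B>"
      | "shift i j A \<notin> \<A>" "shift i j B \<in> \<B>"
      | "shift i j A \<notin> \<A>" "shift i j B \<notin> \<B>" by blast
    then show ?thesis
    proof cases
      case 1 then show ?thesis using c by (simp add: shift_within_def)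
    next
      case 2
      have "t \<le> card (B \<inter> shift i j A)" using cr 2 AB by (auto simp: cross_def Int_commute)
      then have "t \<le> card (shift i j B \<inter> A)"
        using cross_shift_one_moved[of B A i j t] moved[OF 2(2) AB(2)] fin AB ij c
        by (simp add: Int_commute)
      then show ?thesis using 2 by (simp add: shift_within_def Int_commute)
    next
      case 3
      have "t \<le> card (A \<inter> shift i j B)" using cr 3 AB by (auto simp: cross_def)
      then have "t \<le> card (shift i j A \<inter> B)"
        using cross_shift_one_moved[of A B i j t] moved[OF 3(1) AB(1)] fin AB ij c by simp
      then show ?thesis using 3 by (simp add: shift_within_def)
    next
      case 4
      note m = moved[OF 4(1) AB(1)] moved[OF 4(2) AB(2)]
      have "shift i j A \<inter> shift i j B = insert i (A \<inter> B - {j})" using m by (auto simp: shift_eq)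
      then have "card (shift i j A \<inter> shift i j B) = card (A \<inter> B)"
        using m fin AB by (simp add: card_Suc_Diff1 del: card_Diff_insert)
      then show ?thesis using c 4 by (simp add: shift_within_def)
    qed
  qed
  then show ?thesis by (auto simp: cross_def shift_family_def)
qed

text \<open>The measure that makes repeated shifting stop.\<close>

definition element_sum :: "nat set set \<Rightarrow> nat" where
  "element_sum \<A> = (\<Sum>A\<in>\<A>. \<Sum> A)"

lemma element_sum_shift_le:
  assumes "i < j" "\<And>A. A \<in> \<A> \<Longrightarrow> finite A"
  shows "element_sum (shift_family i j \<A>) \<le> element_sum \<A>"
proof -
  have "\<Sum> (shift_within i j \<A> A) \<le> \<Sum> A" if "A \<in> \<A>" for A
  proof (cases "shift i j A = A")
    case False
    then show ?thesis
      using sum_shift_less[of A i j] assms that by (auto simp: shift_within_def)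
  qed (simp add: shift_within_def)
  then have "(\<Sum>A\<in>\<A>. \<Sum> (shift_within i j \<A> A)) \<le> (\<Sum>A\<in>\<A>. \<Sum> A)" by (rule sum_mono)
  then show ?thesis
    by (simp add: element_sum_def shift_family_def sum.reindex[OF inj_on_shift_within])
qed

lemma element_sum_shift_less:
  assumes "i < j" "\<And>A. A \<in> \<A> \<Longrightarrow> finite A" "finite \<A>" "A \<in> \<A>" "shift i j A \<notin> \<A>"
  shows "element_sum (shift_family i j \<A>) < element_sum \<A>"
proof -
  have less: "\<Sum> (shift_within i j \<A> B) < \<Sum> B" if "B \<in> \<A>" "shift i j B \<notin> \<A>" for B
  proof -
    have "shift i j B \<noteq> B" using that by auto
    then show ?thesis using sum_shift_less assms(1,2) that by (simp add: shift_within_def)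
  qed
  have "\<Sum> (shift_within i j \<A> B) \<le> \<Sum> B" if "B \<in> \<A>" for B
    using less[OF that] by (cases "shift i j B \<in> \<A>") (auto simp: shift_within_def)
  then have "(\<Sum>B\<in>\<A>. \<Sum> (shift_within i j \<A> B)) < (\<Sum>B\<in>\<A>. \<Sum> B)"
    using assms less by (intro sum_strict_mono_ex1) blast+
  then show ?thesis
    by (simp add: element_sum_def shift_family_def sum.reindex[OF inj_on_shift_within])
qed

lemma not_compressedE:
  assumes "\<not> compressed n \<A>" "\<A> \<subseteq> Pow {1..n}"
  obtains i j A where "i \<in> {1..n}" "j \<in> {1..n}" "i < j" "A \<in> \<A>" "shift i j A \<notin> \<A>"
proof -
  obtain A i j where *: "A \<in> \<A>" "j \<in> A" "i \<in> {1..n} - A" "i < j" "A - {j} \<union> {i} \<notin> \<A>"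
    using assms(1) unfolding compressed_def by blast
  moreover have "j \<in> {1..n}" using * assms(2) by blast
  moreover have "shift i j A \<notin> \<A>" using * by (simp add: shift_def)
  ultimately show ?thesis using that by blast
qed

context weighted_family
begin

lemma shift_family_subset:
  assumes "\<A> \<subseteq> H" "i \<in> {1..n}" "i < j"
  shows "shift_family i j \<A> \<subseteq> H"
  using assms shift_mem by (auto simp: shift_family_def shift_within_def)

lemma weight_shift_family:
  assumes "\<A> \<subseteq> H" "i \<in> {1..n}" "j \<in> {1..n}" "i < j"
  shows "sum w \<A> \<le> sum w (shift_family i j \<A>)"
proof -
  have "1 * sum w \<A> \<le> sum w (shift_family i j \<A>)"
  proof (rule weight_inj[OF shift_family_subset inj_on_shift_within])
    show "1 * w A \<le> w (shift_within i j \<A> A)" if "A \<in> \<A>" for A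
      using that assms w_shift by (auto simp: shift_within_def)
  qed (use assms in \<open>auto simp: shift_family_def\<close>)
  then show ?thesis by simp
qed

end

section \<open>Compressed cross-intersecting families\<close>

text \<open>A point of \<open>{1..p}\<close> outside \<open>A \<union> B\<close> could replace \<open>p\<close> in \<open>A\<close>; the new set belongs to \<open>\<A>\<close> by
  compression, and inside \<open>{1..p}\<close> it meets \<open>B\<close> in one point less.\<close>

lemma critical_pair:
  assumes compr: "compressed n \<A>" and A: "A \<in> \<A>" "p \<in> A" "p \<in> B" and p: "p \<le> n" and t: "1 \<le> t"
    and cr: "\<And>A. A \<in> \<A> \<Longrightarrow> t \<le> card (A \<inter> B \<inter> {1..p})"
    and crit: "card (A \<inter> B \<inter> {1..p}) = t"
  shows "{1..p} \<subseteq> A \<union> B" and "card (A \<inter> {1..p}) + card (B \<inter> {1..p}) = p + t"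
proof -
  show sub: "{1..p} \<subseteq> A \<union> B"
  proof (rule ccontr)
    assume "\<not> {1..p} \<subseteq> A \<union> B"
    then obtain i where i: "i \<in> {1..p}" "i \<notin> A" "i \<notin> B" by blast
    then have "i \<noteq> p" using A by auto
    then have ip: "i < p" "i \<in> {1..n} - A" using i p by auto
    then have "A - {p} \<union> {i} \<in> \<A>" using compr A(1,2) unfolding compressed_def by blast
    then have "t \<le> card ((A - {p} \<union> {i}) \<inter> B \<inter> {1..p})" by (rule cr)
    also have "(A - {p} \<union> {i}) \<inter> B \<inter> {1..p} = A \<inter> B \<inter> {1..p} - {p}" using i by auto
    also have "card \<dots> = t - 1" using crit A ip by (subst card_Diff_singleton) auto
    finally show False using t by simp
  qed
  have "card (A \<inter> {1..p}) + card (B \<inter> {1..p})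
      = card (A \<inter> {1..p} \<union> B \<inter> {1..p}) + card (A \<inter> {1..p} \<inter> (B \<inter> {1..p}))"
    by (rule card_Un_Int) auto
  also have "A \<inter> {1..p} \<union> B \<inter> {1..p} = {1..p}" using sub by auto
  also have "A \<inter> {1..p} \<inter> (B \<inter> {1..p}) = A \<inter> B \<inter> {1..p}" by auto
  finally show "card (A \<inter> {1..p}) + card (B \<inter> {1..p}) = p + t" using crit by simp
qed

text \<open>Every member of \<open>\<A>\<close> whose trace on \<open>{1..p}\<close> has only \<open>t\<close> points has its trace inside \<open>B\<close>.
  Compression supplies such members through every point of \<open>{1..p}\<close>: move \<open>p\<close> there.\<close>

lemma initial_subset_of_small_trace:
  assumes compr: "compressed n \<A>" and A: "A \<in> \<A>" "p \<in> A" "card (A \<inter> {1..p}) = t" and p: "p \<le> n"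
    and cr: "\<And>A. A \<in> \<A> \<Longrightarrow> t \<le> card (A \<inter> B \<inter> {1..p})"
  shows "{1..p} \<subseteq> B"
proof -
  have sub: "C \<inter> {1..p} \<subseteq> B" if "C \<in> \<A>" "card (C \<inter> {1..p}) = t" for C
  proof -
    have "C \<inter> B \<inter> {1..p} = C \<inter> {1..p}"
      by (rule card_seteq) (use cr that in auto)
    then show ?thesis by blast
  qed
  show ?thesis
  proof
    fix i assume i: "i \<in> {1..p}"
    show "i \<in> B"
    proof (cases "i \<in> A")
      case False
      then have ip: "i < p" "i \<in> {1..n} - A" using i p A by (auto simp: le_less)
      then have "A - {p} \<union> {i} \<in> \<A>" using compr A(1,2) unfolding compressed_def by blast
      moreover have "(A - {p} \<union> {i}) \<inter> {1..p} = insert i (A \<inter> {1..p} - {p})" using i by auto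
      moreover have "card (insert i (A \<inter> {1..p} - {p})) = t"
        using A False ip by (simp add: card_Suc_Diff1 del: card_Diff_insert)
      ultimately have "(A - {p} \<union> {i}) \<inter> {1..p} \<subseteq> B" by (metis sub)
      then show ?thesis using i by blast
    qed (use sub[OF A(1,3)] i in blast)
  qed
qed

text \<open>Compression turns a member of \<open>\<A>\<close> that misses only \<open>i\<close> in \<open>P\<close> into one that misses only \<open>x\<close>,
  for any \<open>x > i\<close> in \<open>P\<close>.  As \<open>B\<close> has just \<open>t\<close> points in \<open>P\<close>, it cannot afford to contain \<open>x\<close>.\<close>

lemma small_trace_below_missing:
  assumes compr: "compressed n \<A>" and A: "A \<in> \<A>" "A \<inter> P = P - {i}" "i \<in> P" and P: "P \<subseteq> {1..n}"
    and cr: "\<And>A. A \<in> \<A> \<Longrightarrow> t \<le> card (A \<inter> B \<inter> P)"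
    and B: "card (B \<inter> P) = t" and t: "1 \<le> t"
  shows "B \<inter> P \<subseteq> {1..<i}"
proof
  fix x assume x: "x \<in> B \<inter> P"
  have fin: "finite P" using P finite_subset by blast
  have "x < i"
  proof (rule ccontr)
    assume "\<not> x < i"
    obtain A' where A': "A' \<in> \<A>" "A' \<inter> P \<subseteq> P - {x}"
    proof (cases "x = i")
      case False
      then have "x \<in> A" "i < x" "i \<in> {1..n} - A" using A x \<open>\<not> x < i\<close> P by auto
      then have "A - {x} \<union> {i} \<in> \<A>" using compr A(1) unfolding compressed_def by blast
      then show ?thesis using that False by blast
    qed (use A that in blast)
    have "A' \<inter> B \<inter> P \<subseteq> B \<inter> P - {x}" using A'(2) by blast
    then have "card (A' \<inter> B \<inter> P) \<le> card (B \<inter> P - {x})" using fin by (intro card_mono) auto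
    also have "\<dots> = t - 1" using x B by simp
    finally show False using cr[OF A'(1)] t by simp
  qed
  then show "x \<in> {1..<i}" using x P by auto
qed

text \<open>The only sets that stop \<open>p\<close> from being removed from the members of \<open>\<S>\<close> are those of \<open>\<T>\<close>: by
  \<open>critical_pair\<close> a set \<open>B\<close> that meets \<open>A - {p}\<close> in too few points has a trace of the
  complementary size \<open>b\<close>, and \<open>B - {p}\<close> is not in \<open>\<B>\<close> since it would meet \<open>A\<close> in too few points.\<close>

lemma cross_swap:
  assumes compr: "compressed n \<A>" and p: "p \<le> n" and t: "1 \<le> t"
    and fin: "\<And>A. A \<in> \<A> \<Longrightarrow> finite A"
    and cr: "\<And>A B. A \<in> \<A> \<Longrightarrow> B \<in> \<B> \<Longrightarrow> t \<le> card (A \<inter> B \<inter> {1..p})"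
    and ab: "a + b = p + t"
    and \<S>: "\<And>A. A \<in> \<S> \<Longrightarrow> A \<in> \<A> \<and> p \<in> A \<and> card (A \<inter> {1..p}) = a"
    and \<T>: "\<And>B. B \<in> \<B> \<Longrightarrow> p \<in> B \<Longrightarrow> card (B \<inter> {1..p}) = b \<Longrightarrow> B - {p} \<notin> \<B> \<Longrightarrow> B \<in> \<T>"
  shows "cross t (\<A> \<union> (\<lambda>A. A - {p}) ` \<S>) (\<B> - \<T>)"
proof -
  have old: "t \<le> card (A \<inter> B)" if "A \<in> \<A>" "B \<in> \<B>" for A B
    using cr[OF that] card_mono[of "A \<inter> B" "A \<inter> B \<inter> {1..p}"] fin that by fastforce
  have new: "t \<le> card ((A - {p}) \<inter> B)" if A: "A \<in> \<S>" and B: "B \<in> \<B>" "B \<notin> \<T>" for A B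
  proof (rule ccontr)
    assume small: "\<not> ?thesis"
    have A': "A \<in> \<A>" "p \<in> A" "card (A \<inter> {1..p}) = a" using \<S>[OF A] by auto
    have "card ((A - {p}) \<inter> B \<inter> {1..p}) \<le> card ((A - {p}) \<inter> B)"
      using fin A' by (intro card_mono) auto
    then have lt: "card ((A - {p}) \<inter> B \<inter> {1..p}) < t" using small by simp
    have ge: "t \<le> card (A \<inter> B \<inter> {1..p})" using cr A' B by simp
    have "p \<in> A \<inter> B \<inter> {1..p}"
    proof (rule ccontr)
      assume "p \<notin> A \<inter> B \<inter> {1..p}"
      then have "(A - {p}) \<inter> B \<inter> {1..p} = A \<inter> B \<inter> {1..p}" by auto
      then show False using lt ge by simp
    qed
    moreover have eq: "(A - {p}) \<inter> B \<inter> {1..p} = A \<inter> B \<inter> {1..p} - {p}" by auto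
    ultimately have crit: "card (A \<inter> B \<inter> {1..p}) = t" "p \<in> B" using lt ge by auto
    have "card (A \<inter> {1..p}) + card (B \<inter> {1..p}) = p + t"
      by (rule critical_pair(2)[OF compr A'(1,2) crit(2) p t _ crit(1)]) (use cr B in auto)
    then have "card (B \<inter> {1..p}) = b" using A' ab by simp
    moreover have "B - {p} \<notin> \<B>"
    proof
      assume "B - {p} \<in> \<B>"
      then have "t \<le> card (A \<inter> (B - {p}) \<inter> {1..p})" using cr A' by simp
      also have "A \<inter> (B - {p}) \<inter> {1..p} = (A - {p}) \<inter> B \<inter> {1..p}" by auto
      finally show False using lt by simp
    qed
    ultimately show False using \<T> B crit by blast
  qed
  show ?thesis unfolding cross_def using old new by auto
qed

section \<open>The weights of compressed cross-intersecting families\<close>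

text \<open>The comparisons below hold for \<open>c \<ge> t\<close> and become strict for \<open>c > t\<close>; the strict part is what
  characterises equality.\<close>

definition dominated :: "nat \<Rightarrow> real \<Rightarrow> real \<Rightarrow> real \<Rightarrow> bool" where
  "dominated t c x y \<longleftrightarrow> x \<le> y \<and> (real t < c \<longrightarrow> x < y)"

lemma choose_le_power: "(t + d) choose t \<le> (t + 1) ^ d"
proof (induction d)
  case (Suc d)
  have sym: "(t + e) choose t = (t + e) choose e" for e
    using binomial_symmetric[of t "t + e"] by simp
  have "Suc d * ((t + Suc d) choose Suc d) = (t + d + 1) * ((t + d) choose d)"
    using Suc_times_binomial[of d "t + d"] by simp
  also have "\<dots> \<le> (Suc d * (t + 1)) * (t + 1) ^ d"
    using Suc.IH sym[of d] by (intro mult_mono) auto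
  also have "\<dots> = Suc d * (t + 1) ^ Suc d" by (simp only: power_Suc mult.assoc)
  finally have "(t + Suc d) choose Suc d \<le> (t + 1) ^ Suc d"
    by (simp only: Suc_mult_le_cancel1)
  then show ?case using sym[of "Suc d"] by simp
qed simp

text \<open>\<open>\<A>\<close> is covered by the members above the \<open>t\<close>-subsets of \<open>{1..p}\<close>, none of which weighs more than the
  members above \<open>{1..t}\<close>, while \<open>\<B>\<close> lies above \<open>{1..p}\<close> and loses a factor \<open>1 + c\<close> for each of
  the \<open>p - t\<close> additional points.\<close>

lemma dominated_full_trace:
  assumes wG: "weighted_family n t c G g" and wH: "weighted_family n t c H h"
    and T: "{1..t} \<in> G" "{1..t} \<in> H" and p: "t < p" "p \<le> n"
    and \<A>: "\<A> \<subseteq> G" "\<And>A. A \<in> \<A> \<Longrightarrow> t \<le> card (A \<inter> {1..p})"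
    and \<B>: "\<B> \<subseteq> H" "\<And>B. B \<in> \<B> \<Longrightarrow> {1..p} \<subseteq> B"
  shows "dominated t c (sum g \<A> * sum h \<B>)
    (sum g (members_above G {1..t}) * sum h (members_above H {1..t}))"
proof -
  interpret G: weighted_family n t c G g by (rule wG)
  interpret H: weighted_family n t c H h by (rule wH)
  define gT hT hp d where "gT = sum g (members_above G {1..t})"
    and "hT = sum h (members_above H {1..t})" and "hp = sum h (members_above H {1..p})"
    and "d = p - t"
  have pd: "p = t + d" "0 < d" using p by (auto simp: d_def)
  have gT: "0 < gT" unfolding gT_def
    by (rule G.weight_initial_pos[OF T(1)])
  have hT: "0 < hT" unfolding hT_def
    by (rule H.weight_initial_pos[OF T(2)])
  have hp0: "0 \<le> hp" unfolding hp_def by (rule H.weight_nonneg[OF H.above_subset])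
  define I where "I = {S. S \<subseteq> {1..p} \<and> card S = t}"
  have finI: "finite I" unfolding I_def by (rule finite_subset[of _ "Pow {1..p}"]) auto
  have "sum g \<A> \<le> sum g (\<Union>S\<in>I. members_above G S)"
  proof (rule G.weight_mono)
    show "\<A> \<subseteq> (\<Union>S\<in>I. members_above G S)"
    proof
      fix A assume A: "A \<in> \<A>"
      obtain S where "S \<subseteq> A \<inter> {1..p}" "card S = t"
        using \<A>(2)[OF A] by (meson obtain_subset_with_card_n)
      then show "A \<in> (\<Union>S\<in>I. members_above G S)"
        using A \<A>(1) by (auto simp: I_def members_above_def)
    qed
  qed (auto simp: members_above_def)
  also have "\<dots> \<le> (\<Sum>S\<in>I. sum g (members_above G S))"
    by (rule G.weight_UN_le[OF finI G.above_subset])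
  also have "\<dots> \<le> (\<Sum>S\<in>I. gT)"
  proof (rule sum_mono)
    fix S assume "S \<in> I"
    then have "S \<subseteq> {1..n}" "card S = t" using p by (auto simp: I_def)
    then show "sum g (members_above G S) \<le> gT" using G.weight_above_initial unfolding gT_def by blast
  qed
  also have "\<dots> = real (card I) * gT" by simp
  also have "card I = (t + d) choose t" using n_subsets[of "{1..p}" t] pd by (simp add: I_def)
  also have "real ((t + d) choose t) * gT \<le> real ((t + 1) ^ d) * gT"
    using choose_le_power gT by (intro mult_right_mono of_nat_mono) auto
  finally have gA: "sum g \<A> \<le> (real t + 1) ^ d * gT" by (simp add: add.commute)
  have hB: "sum h \<B> \<le> hp" unfolding hp_def
    by (rule H.weight_mono[OF _ H.above_subset]) (use \<B> in \<open>auto simp: members_above_def\<close>)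
  have hp: "(1 + c) ^ d * hp \<le> hT"
    using H.weight_above_initial_power[of d] by (simp add: hp_def hT_def pd)
  have "sum g \<A> * sum h \<B> \<le> ((real t + 1) ^ d * gT) * hp"
    using gA hB hp0 gT H.weight_nonneg[OF \<B>(1)] by (intro mult_mono) auto
  also have "\<dots> = gT * ((real t + 1) ^ d * hp)" by simp
  finally have prod: "sum g \<A> * sum h \<B> \<le> gT * ((real t + 1) ^ d * hp)" .
  have "(real t + 1) ^ d * hp \<le> (1 + c) ^ d * hp"
    using G.c_ge hp0 by (intro mult_right_mono power_mono) auto
  then have le: "(real t + 1) ^ d * hp \<le> hT" using hp by simp
  have less: "(real t + 1) ^ d * hp < hT" if "real t < c"
  proof (cases "hp = 0")
    case False
    then have "(real t + 1) ^ d * hp < (1 + c) ^ d * hp"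
      using that hp0 pd by (intro mult_strict_right_mono power_strict_mono) auto
    then show ?thesis using hp by simp
  qed (use hT in simp)
  show ?thesis
    unfolding dominated_def gT_def[symmetric] hT_def[symmetric]
  proof (intro conjI impI)
    show "sum g \<A> * sum h \<B> \<le> gT * hT" 
      by (rule order_trans[OF prod mult_left_mono[OF le]]) (use gT in simp)
    show "sum g \<A> * sum h \<B> < gT * hT" if "real t < c"
      by (rule le_less_trans[OF prod mult_strict_left_mono[OF less[OF that] gT]])
  qed
qed

text \<open>As \<open>A0\<close> misses a point \<open>i \<le> t\<close>, no member of \<open>\<B>\<close> can have a trace of size only \<open>t\<close>.  If the same
  holds for \<open>\<A>\<close>, each family on its own weighs at most as much as the members above \<open>{1..t}\<close>.
  Otherwise the exceptional trace in \<open>\<A>\<close> is \<open>{1..t}\<close>; then \<open>\<A>\<close> may be heavier, but \<open>\<B>\<close> lies above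
  \<open>{1..t + 1}\<close> or \<open>{1..t} \<union> {t + 2}\<close> and is too light.\<close>

lemma dominated_two_extra_points:
  assumes wG: "weighted_family n t c G g" and wH: "weighted_family n t c H h"
    and T: "{1..t} \<in> G" "{1..t} \<in> H" and n: "t + 2 \<le> n"
    and sub: "\<A> \<subseteq> G" "\<B> \<subseteq> H" and compr: "compressed n \<A>" "compressed n \<B>"
    and cr: "\<And>A B. A \<in> \<A> \<Longrightarrow> B \<in> \<B> \<Longrightarrow> t \<le> card (A \<inter> B \<inter> {1..t + 2})"
    and A0: "A0 \<in> \<A>" "A0 \<inter> {1..t + 2} = {1..t + 2} - {i}" "i \<in> {1..t}"
    and B0: "B0 \<in> \<B>" "B0 \<inter> {1..t + 2} = {1..t + 2} - {j}" "j \<in> {1..t + 1}"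
  shows "dominated t c (sum g \<A> * sum h \<B>)
    (sum g (members_above G {1..t}) * sum h (members_above H {1..t}))"
proof -
  interpret G: weighted_family n t c G g by (rule wG)
  interpret H: weighted_family n t c H h by (rule wH)
  define P where "P = {1..t + 2}"
  define gT hT where "gT = sum g (members_above G {1..t})" and "hT = sum h (members_above H {1..t})"
  have gT: "0 < gT" unfolding gT_def
    by (rule G.weight_initial_pos[OF T(1)])
  have hT: "0 < hT" unfolding hT_def
    by (rule H.weight_initial_pos[OF T(2)])
  have PT: "{1..t} \<inter> P = {1..t}" "finite P" "P \<subseteq> {1..n}" using n by (auto simp: P_def)
  have t: "1 \<le> t" by (rule G.t_pos)
  have trace: "t \<le> card (A \<inter> P)" "t \<le> card (B \<inter> P)" if "A \<in> \<A>" "B \<in> \<B>" for A B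
  proof -
    have "t \<le> card (A \<inter> B \<inter> P)" using cr that by (simp add: P_def)
    moreover have "card (A \<inter> B \<inter> P) \<le> card (A \<inter> P)" "card (A \<inter> B \<inter> P) \<le> card (B \<inter> P)"
      using PT(2) by (auto intro!: card_mono)
    ultimately show "t \<le> card (A \<inter> P)" "t \<le> card (B \<inter> P)" by linarith+
  qed
  have bigB: "t + 1 \<le> card (B \<inter> P)" if B: "B \<in> \<B>" for B
  proof (rule ccontr)
    assume "\<not> ?thesis"
    then have eq: "card (B \<inter> P) = t" using trace[OF A0(1) B] by simp
    have "B \<inter> P \<subseteq> {1..<i}"
      by (rule small_trace_below_missing[OF compr(1) A0(1) _ _ PT(3) _ eq t])
        (use A0 B cr in \<open>auto simp: P_def\<close>)
    then have "card (B \<inter> P) \<le> card {1..<i}" by (intro card_mono) auto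
    then show False using eq A0(3) by auto
  qed
  note large = G.weight_large_trace[folded P_def gT_def] H.weight_large_trace[folded P_def hT_def]
  define E0 where "E0 G = {A \<in> G. A \<inter> P = {1..t}}" for G :: "nat set set"
  define E1 where "E1 G = {A \<in> G. A \<inter> P = P - {t + 1}}" for G :: "nat set set"
  define W where "W G = {A \<in> G. t + 1 \<le> card (A \<inter> P)}" for G :: "nat set set"
  note large' = large[folded E0_def E1_def W_def]
  have WG: "W G \<subseteq> G" and WH: "W H \<subseteq> H" by (auto simp: W_def)
  have E0G: "E0 G \<subseteq> G" "E1 G \<subseteq> G" and E0H: "E0 H \<subseteq> H" "E1 H \<subseteq> H" by (auto simp: E0_def E1_def)
  have E0pos: "0 < sum g (E0 G)" "0 < sum h (E0 H)"
    using G.weight_pos[OF E0G(1), of "{1..t}"] H.weight_pos[OF E0H(1), of "{1..t}"] T PT(1)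
    by (auto simp: E0_def)
  have E1pos: "0 \<le> sum g (E1 G)" "0 \<le> sum h (E1 H)"
    using G.weight_nonneg[OF E0G(2)] H.weight_nonneg[OF E0H(2)] by auto
  have BW: "\<B> \<subseteq> W H" using bigB sub by (auto simp: W_def)
  have c: "8 / 3 < c" "real t \<le> c" using G.c_gt G.c_ge t by auto
  (* The t surplus traces weigh at most t * e, the forgone sets with trace {1..t} at least c * e. *)
  have small: "real t * e \<le> f \<and> (real t < c \<longrightarrow> real t * e < f)"
    if ef: "0 \<le> e" "0 < f" "c * e \<le> f" for e f :: real
  proof (cases "e = 0")
    case False
    then have "0 < e" using ef by simp
    then have "real t * e \<le> c * e" "real t < c \<Longrightarrow> real t * e < c * e" using c by auto
    then show ?thesis using ef by auto
  qed (use ef in auto)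
  show ?thesis
  proof (cases "\<forall>A\<in>\<A>. t + 1 \<le> card (A \<inter> P)")
    case True
    then have AW: "\<A> \<subseteq> W G" using sub by (auto simp: W_def)
    have a: "sum g \<A> \<le> sum g (W G)" "sum h \<B> \<le> sum h (W H)"
      using G.weight_mono[OF AW WG] H.weight_mono[OF BW WH] by auto
    have nn: "0 \<le> sum h \<B>" "0 \<le> sum g \<A>" using H.weight_nonneg G.weight_nonneg sub by auto
    have "sum g \<A> \<le> gT" "real t < c \<Longrightarrow> sum g \<A> < gT" "sum h \<B> \<le> hT" "real t < c \<Longrightarrow> sum h \<B> < hT"
      using a large'(1,4) small[OF E1pos(1) E0pos(1) large'(2)] small[OF E1pos(2) E0pos(2) large'(5)]
      by auto
    then show ?thesis
      unfolding dominated_def gT_def[symmetric] hT_def[symmetric]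
      using nn by (auto intro: mult_mono mult_strict_mono')
  next
    case False
    have trace_t: "A \<inter> P = {1..t} \<and> j = t + 1" if A: "A \<in> \<A>" "\<not> t + 1 \<le> card (A \<inter> P)" for A
    proof -
      have eq: "card (A \<inter> P) = t" using trace[OF A(1) B0(1)] A by simp
      have cr': "t \<le> card (B \<inter> A \<inter> P)" if "B \<in> \<B>" for B
        using cr[OF A(1) that] by (simp add: P_def Int_commute[of B A])
      have s: "A \<inter> P \<subseteq> {1..<j}"
        by (rule small_trace_below_missing[OF compr(2) B0(1) _ _ PT(3) cr' eq t])
          (use B0 in \<open>auto simp: P_def\<close>)
      then have "card (A \<inter> P) \<le> card {1..<j}" by (intro card_mono) auto
      then have j: "j = t + 1" using eq B0(3) by auto
      moreover have "A \<inter> P = {1..<j}"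
        by (rule card_subset_eq[OF _ s]) (use eq j in auto)
      moreover have "{1..<j} = {1..t}" using j by auto
      ultimately show ?thesis by simp
    qed
    obtain A1 where A1: "A1 \<in> \<A>" "A1 \<inter> P = {1..t}" using False trace_t by blast
    have BT: "{1..t} \<subseteq> B" if B: "B \<in> \<B>" for B
    proof -
      have "A1 \<inter> B \<inter> P = A1 \<inter> P"
      proof (rule card_seteq)
        have "t \<le> card (A1 \<inter> B \<inter> P)" using cr[OF A1(1) B] by (simp add: P_def)
        then show "card (A1 \<inter> P) \<le> card (A1 \<inter> B \<inter> P)" using A1 by simp
      qed (use PT in auto)
      then show ?thesis using A1 by blast
    qed
    have "\<A> \<subseteq> W G \<union> E0 G" using trace_t sub by (auto simp: W_def E0_def)
    then have "sum g \<A> \<le> sum g (W G \<union> E0 G)" by (rule G.weight_mono) (use WG E0G in auto)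
    also have "\<dots> \<le> sum g (W G) + sum g (E0 G)" by (rule G.weight_Un_le[OF WG E0G(1)])
    also have "\<dots> \<le> gT + real t * sum g (E1 G)" using large'(1) by simp
    also have "\<dots> \<le> gT + c * sum g (E1 G)" using c E1pos by (intro add_left_mono mult_right_mono) auto
    finally have "(1 + c) * sum g \<A> \<le> (1 + c) * (gT + c * sum g (E1 G))"
      using c by (intro mult_left_mono) auto
    also have "\<dots> = (1 + c) * gT + c * ((1 + c) * sum g (E1 G))" by (simp add: algebra_simps)
    also have "\<dots> \<le> (1 + c) * gT + c * gT"
      using large'(3) c by (intro add_left_mono mult_left_mono) auto
    finally have gA: "(1 + c) * sum g \<A> \<le> (1 + 2 * c) * gT" by (simp add: algebra_simps)
    have "\<B> \<subseteq> members_above H (insert (t + 1) {1..t}) \<union> members_above H (insert (t + 2) {1..t})"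
    proof
      fix B assume B: "B \<in> \<B>"
      have "\<not> B \<inter> P \<subseteq> {1..t}"
      proof
        assume "B \<inter> P \<subseteq> {1..t}"
        then have "card (B \<inter> P) \<le> card {1..t}" by (intro card_mono) auto
        then show False using bigB[OF B] by simp
      qed
      then obtain x where x: "x \<in> B" "x \<in> P" "x \<notin> {1..t}" by blast
      then have "x = t + 1 \<or> x = t + 2" by (auto simp: P_def)
      then show "B \<in> members_above H (insert (t + 1) {1..t}) \<union> members_above H (insert (t + 2) {1..t})"
        using x BT[OF B] B sub unfolding members_above_def by blast
    qed
    then have "sum h \<B> \<le> sum h (members_above H (insert (t + 1) {1..t}) \<union> members_above H (insert (t + 2) {1..t}))"
      by (rule H.weight_mono) (auto simp: members_above_def)
    also have "\<dots> \<le> sum h (members_above H (insert (t + 1) {1..t})) + sum h (members_above H (insert (t + 2) {1..t}))"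
      by (rule H.weight_Un_le[OF H.above_subset H.above_subset])
    finally have "(1 + c) * sum h \<B> \<le> (1 + c) * (sum h (members_above H (insert (t + 1) {1..t})) + sum h (members_above H (insert (t + 2) {1..t})))"
      using c by (intro mult_left_mono) auto
    also have "\<dots> \<le> 2 * hT"
      using H.weight_above_insert[of "{1..t}" "t + 1"] H.weight_above_insert[of "{1..t}" "t + 2"]
      by (simp add: hT_def algebra_simps)
    finally have hB: "(1 + c) * sum h \<B> \<le> 2 * hT" .
    have "((1 + c) * sum g \<A>) * ((1 + c) * sum h \<B>) \<le> ((1 + 2 * c) * gT) * (2 * hT)"
      by (rule mult_mono[OF gA hB]) (use c gT H.weight_nonneg[OF sub(2)] in auto)
    then have "(1 + c)\<^sup>2 * (sum g \<A> * sum h \<B>) \<le> (2 * (1 + 2 * c)) * (gT * hT)"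
      by (simp add: power2_eq_square algebra_simps)
    also have "\<dots> < (1 + c)\<^sup>2 * (gT * hT)"
    proof (rule mult_strict_right_mono)
      (* 8 / 3 exceeds the larger root 1 + sqrt 2 of c ^ 2 - 2 * c - 1. *)
      have "8 * (c - 2) \<le> (3 * c) * (c - 2)" using c by (intro mult_right_mono) auto
      then have "8 * c - 16 \<le> 3 * (c * c) - 6 * c" by (simp add: algebra_simps)
      moreover have "8 < 3 * c" using c by simp
      ultimately have "2 * (1 + 2 * c) < 1 + 2 * c + c * c" by simp
      also have "\<dots> = (1 + c)\<^sup>2" by (simp add: power2_eq_square algebra_simps)
      finally show "2 * (1 + 2 * c) < (1 + c)\<^sup>2" .
    qed (use gT hT in simp)
    finally have "sum g \<A> * sum h \<B> < gT * hT" using c by (simp add: mult_less_cancel_left)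
    then show ?thesis unfolding dominated_def gT_def[symmetric] hT_def[symmetric] by simp
  qed
qed

text \<open>Put \<open>X = M / \<alpha>\<close> and \<open>Y = N / \<beta>\<close>.  The two exchanges give \<open>c * Y \<le> X + c\<close> and \<open>c * X \<le> Y + c\<close>,
  hence \<open>(c - 1) * (X + Y) \<le> 2 * c\<close>.  On the other hand \<open>X \<ge> p / a\<close> and \<open>Y \<ge> p / b\<close>, so that
  \<open>X + Y \<ge> 4 * p / (p + t)\<close> by the inequality of arithmetic and harmonic means.  Together
  \<open>c * (p - t) \<le> 2 * p\<close>, which contradicts the lower bound on \<open>c\<close> when \<open>p - t \<ge> 3\<close>.\<close>

lemma swap_arithmetic:
  fixes c M N \<alpha> \<beta> :: real and p a b t :: nat
  assumes c: "2 + 2 * real t / 3 < c" and p: "t + 3 \<le> p" and ab: "a + b = p + t" "0 < a" "0 < b"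
    and pos: "0 < \<alpha>" "0 < \<beta>"
    and small: "real p * \<alpha> \<le> real a * M" "real p * \<beta> \<le> real b * N"
    and swap: "(M + c * \<alpha>) * (N - \<beta>) \<le> M * N" "(M - \<alpha>) * (N + c * \<beta>) \<le> M * N"
  shows False
proof -
  define X Y where "X = M / \<alpha>" and "Y = N / \<beta>"
  have MN: "M = X * \<alpha>" "N = Y * \<beta>" using pos by (auto simp: X_def Y_def)
  have "(c * Y - X - c) * (\<alpha> * \<beta>) \<le> 0" "(c * X - Y - c) * (\<alpha> * \<beta>) \<le> 0"
    using swap by (simp_all add: MN algebra_simps)
  then have "c * Y - X - c \<le> 0" "c * X - Y - c \<le> 0"
    using pos by (simp_all add: mult_le_0_iff)
  then have up: "(c - 1) * (X + Y) \<le> 2 * c" by (simp add: algebra_simps)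
  have XY: "real p / a \<le> X" "real p / b \<le> Y"
    using small pos ab by (simp_all add: X_def Y_def field_simps)
  have c1: "1 < c" using c by (smt (verit) of_nat_0_le_iff divide_nonneg_pos)
  have "4 * (real a * b) \<le> (real a + b)\<^sup>2"
    using sum_squares_ge_zero[of "real a - b" 0] by (simp add: power2_eq_square algebra_simps)
  then have "4 \<le> (real a + b) * (1 / real a + 1 / b)"
    using ab(2,3) by (simp add: field_simps power2_eq_square)
  then have "real p * 4 \<le> real p * ((real a + b) * (1 / real a + 1 / b))"
    by (rule mult_left_mono) simp
  also have "\<dots> = (real a + b) * (real p / a + real p / b)"
    by (simp add: divide_inverse algebra_simps)
  also have "\<dots> \<le> (real a + b) * (X + Y)" using XY by (intro mult_left_mono add_mono) auto
  also have "real a + b = real p + t" using ab(1) by linarith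
  finally have "(c - 1) * (real p * 4) \<le> (c - 1) * ((real p + t) * (X + Y))"
    using c1 by (intro mult_left_mono) auto
  also have "\<dots> = (real p + t) * ((c - 1) * (X + Y))" by simp
  also have "\<dots> \<le> (real p + t) * (2 * c)" using up by (intro mult_left_mono) auto
  finally have upper: "c * (real p - t) \<le> 2 * real p" by (simp add: algebra_simps)
  have d: "3 \<le> real p - t" using p by linarith
  have c3: "6 + 2 * real t < 3 * c" using c by (simp add: field_simps)
  have "(6 + 2 * real t) * (real p - t) < (3 * c) * (real p - t)"
    using c3 d by (intro mult_strict_right_mono) auto
  moreover have "2 * real t * 3 \<le> 2 * real t * (real p - t)"
    using d by (intro mult_left_mono) auto
  ultimately have "6 * (real p - t) + 6 * real t < 3 * (c * (real p - t))"
    by (simp add: algebra_simps)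
  then show False using upper by simp
qed

text \<open>\<open>\<S>\<close> and \<open>\<T>\<close> are the critical sets of the two families, those that need their point \<open>p\<close>.  One of the
  two exchanges, removing \<open>p\<close> on one side and discarding the critical sets on the other,
  increases the product.\<close>

lemma swap_increases:
  assumes wG: "weighted_family n t c G g" and wH: "weighted_family n t c H h"
    and sub: "\<A> \<subseteq> G" "\<B> \<subseteq> H" and compr: "compressed n \<A>" "compressed n \<B>"
    and p: "t + 3 \<le> p" "p \<le> n"
    and cr: "\<And>A B. A \<in> \<A> \<Longrightarrow> B \<in> \<B> \<Longrightarrow> t \<le> card (A \<inter> B \<inter> {1..p})"
    and A0: "A0 \<in> \<A>" "p \<in> A0" "card (A0 \<inter> {1..p}) = a" "t < a"
    and B0: "B0 \<in> \<B>" "p \<in> B0" "card (B0 \<inter> {1..p}) = b" "t < b"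
    and crit: "card (A0 \<inter> B0 \<inter> {1..p}) = t" and ab: "a + b = p + t"
    and opt: "\<And>\<A>' \<B>'. \<A>' \<subseteq> G \<Longrightarrow> \<B>' \<subseteq> H \<Longrightarrow> cross t \<A>' \<B>' \<Longrightarrow>
      sum g \<A>' * sum h \<B>' \<le> sum g \<A> * sum h \<B>"
  shows False
proof -
  interpret G: weighted_family n t c G g by (rule wG)
  interpret H: weighted_family n t c H h by (rule wH)
  define \<S> where "\<S> = {A \<in> \<A>. p \<in> A \<and> card (A \<inter> {1..p}) = a \<and> A - {p} \<notin> \<A>}"
  define \<T> where "\<T> = {B \<in> \<B>. p \<in> B \<and> card (B \<inter> {1..p}) = b \<and> B - {p} \<notin> \<B>}"
  note t = G.t_pos
  have fin: "finite A" "finite B" if "A \<in> \<A>" "B \<in> \<B>" for A B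
    using that sub G.finite_member H.finite_member by auto
  have card_le: "card (A \<inter> {1..p}) \<le> card A" if "finite A" for A
    using that by (intro card_mono) auto
  have crit': "card ((A0 - {p}) \<inter> B0 \<inter> {1..p}) < t" "card (A0 \<inter> (B0 - {p}) \<inter> {1..p}) < t"
  proof -
    have "(A0 - {p}) \<inter> B0 \<inter> {1..p} = A0 \<inter> B0 \<inter> {1..p} - {p}"
      "A0 \<inter> (B0 - {p}) \<inter> {1..p} = A0 \<inter> B0 \<inter> {1..p} - {p}" by auto
    moreover have "card (A0 \<inter> B0 \<inter> {1..p} - {p}) < t"
      using crit A0 B0 p t by simp
    ultimately show "card ((A0 - {p}) \<inter> B0 \<inter> {1..p}) < t" "card (A0 \<inter> (B0 - {p}) \<inter> {1..p}) < t"
      by simp_all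
  qed
  have S0: "A0 \<in> \<S>" and T0: "B0 \<in> \<T>"
    using A0 B0 crit' cr by (auto simp: \<S>_def \<T>_def leD)
  have SH: "\<S> \<subseteq> \<A>" "\<T> \<subseteq> \<B>" by (auto simp: \<S>_def \<T>_def)
  have pos: "0 < sum g \<S>" "0 < sum h \<T>"
    using G.weight_pos[of \<S> A0] H.weight_pos[of \<T> B0] S0 T0 SH sub by auto
  have diff: "sum g (\<A> - \<S>) = sum g \<A> - sum g \<S>" "sum h (\<B> - \<T>) = sum h \<B> - sum h \<T>"
    using SH sub G.finite_subfamily H.finite_subfamily by (auto intro!: sum_diff)
  have remS: "p \<in> A \<and> t < card A \<and> A - {p} \<notin> \<A>" if "A \<in> \<S>" for A
    using that A0(4) fin(1)[OF _ B0(1), of A] card_le[of A] by (auto simp: \<S>_def)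
  have remT: "p \<in> B \<and> t < card B \<and> B - {p} \<notin> \<B>" if "B \<in> \<T>" for B
    using that B0(4) fin(2)[OF A0(1), of B] card_le[of B] by (auto simp: \<T>_def)
  note outS = G.weight_remove_point[OF sub(1) SH(1) remS]
  note outT = H.weight_remove_point[OF sub(2) SH(2) remT]
  have cr1: "cross t (\<A> \<union> (\<lambda>A. A - {p}) ` \<S>) (\<B> - \<T>)"
    by (rule cross_swap[OF compr(1) p(2) t _ cr ab]) (use fin B0(1) in \<open>auto simp: \<S>_def \<T>_def\<close>)
  have cr_flip: "t \<le> card (B \<inter> A \<inter> {1..p})" if "B \<in> \<B>" "A \<in> \<A>" for A B
    using cr[OF that(2,1)] by (simp add: Int_commute[of B A])
  have cr2: "cross t (\<B> \<union> (\<lambda>A. A - {p}) ` \<T>) (\<A> - \<S>)"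
    by (rule cross_swap[OF compr(2) p(2) t _ cr_flip, where a = b and b = a])
      (use fin A0(1) ab in \<open>auto simp: \<S>_def \<T>_def\<close>)
  have "(sum g \<A> + c * sum g \<S>) * (sum h \<B> - sum h \<T>)
      \<le> sum g (\<A> \<union> (\<lambda>A. A - {p}) ` \<S>) * sum h (\<B> - \<T>)"
    unfolding diff[symmetric]
    by (rule mult_right_mono[OF outS(2) H.weight_nonneg]) (use sub in auto)
  also have "\<dots> \<le> sum g \<A> * sum h \<B>"
    by (rule opt[OF _ _ cr1]) (use sub outS(1) in auto)
  finally have swap1: "(sum g \<A> + c * sum g \<S>) * (sum h \<B> - sum h \<T>) \<le> sum g \<A> * sum h \<B>" .
  have "(sum g \<A> - sum g \<S>) * (sum h \<B> + c * sum h \<T>)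
      \<le> sum g (\<A> - \<S>) * sum h (\<B> \<union> (\<lambda>A. A - {p}) ` \<T>)"
    unfolding diff[symmetric]
    by (rule mult_left_mono[OF outT(2) G.weight_nonneg]) (use sub in auto)
  also have "\<dots> \<le> sum g \<A> * sum h \<B>"
    by (rule opt) (use sub outT(1) cr2 cross_commute in auto)
  finally have swap2: "(sum g \<A> - sum g \<S>) * (sum h \<B> + c * sum h \<T>) \<le> sum g \<A> * sum h \<B>" .
  have smallS: "real p * sum g \<S> \<le> real a * sum g \<A>"
    by (rule G.weight_containing_last[OF sub(1) compr(1) p(2)]) (auto simp: \<S>_def)
  have smallT: "real p * sum h \<T> \<le> real b * sum h \<B>"
    by (rule H.weight_containing_last[OF sub(2) compr(2) p(2)]) (auto simp: \<T>_def)
  show False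
    by (rule swap_arithmetic[OF G.c_gt p(1) ab _ _ pos smallS smallT swap1 swap2]) (use A0 B0 in auto)
qed

text \<open>Take the least \<open>p\<close> such that any two members from different families meet in \<open>t\<close> points of
  \<open>{1..p}\<close>.  If \<open>p > t\<close>, there is a critical pair with trace sizes \<open>a + b = p + t\<close>; when both exceed
  \<open>t\<close>, this forces \<open>p \<ge> t + 2\<close>, and from \<open>p = t + 3\<close> on an exchange would improve the optimum.\<close>

lemma compressed_optimum:
  assumes wG: "weighted_family n t c G g" and wH: "weighted_family n t c H h"
    and T: "{1..t} \<in> G" "{1..t} \<in> H"
    and sub: "\<A> \<subseteq> G" "\<B> \<subseteq> H" and compr: "compressed n \<A>" "compressed n \<B>"
    and cr: "cross t \<A> \<B>"
    and opt: "\<And>\<A>' \<B>'. \<A>' \<subseteq> G \<Longrightarrow> \<B>' \<subseteq> H \<Longrightarrow> cross t \<A>' \<B>' \<Longrightarrow>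
      sum g \<A>' * sum h \<B>' \<le> sum g \<A> * sum h \<B>"
  shows "(\<A> \<subseteq> members_above G {1..t} \<and> \<B> \<subseteq> members_above H {1..t}) \<or>
    dominated t c (sum g \<A> * sum h \<B>)
      (sum g (members_above G {1..t}) * sum h (members_above H {1..t}))"
proof (cases "\<A> = {} \<or> \<B> = {}")
  case True
  interpret G: weighted_family n t c G g by (rule wG)
  interpret H: weighted_family n t c H h by (rule wH)
  have "0 < sum g (members_above G {1..t})"
    by (rule G.weight_initial_pos[OF T(1)])
  moreover have "0 < sum h (members_above H {1..t})"
    by (rule H.weight_initial_pos[OF T(2)])
  ultimately show ?thesis using True by (auto simp: dominated_def)
next
  case False
  interpret G: weighted_family n t c G g by (rule wG)
  interpret H: weighted_family n t c H h by (rule wH)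
  note t = G.t_pos
  define Q where "Q p \<longleftrightarrow> (\<forall>A\<in>\<A>. \<forall>B\<in>\<B>. t \<le> card (A \<inter> B \<inter> {1..p}))" for p
  define p where "p = (LEAST p. Q p)"
  have "Q n" unfolding Q_def
  proof (intro ballI)
    fix A B assume AB: "A \<in> \<A>" "B \<in> \<B>"
    then have "A \<inter> B \<inter> {1..n} = A \<inter> B" using sub G.ground by blast
    then show "t \<le> card (A \<inter> B \<inter> {1..n})" using cr AB by (simp add: cross_def)
  qed
  then have "Q p" "p \<le> n" unfolding p_def by (auto intro: LeastI Least_le)
  have crp: "t \<le> card (A \<inter> B \<inter> {1..p})" if "A \<in> \<A>" "B \<in> \<B>" for A B
    using \<open>Q p\<close> that by (simp add: Q_def)
  have crp': "t \<le> card (B \<inter> A \<inter> {1..p})" if "B \<in> \<B>" "A \<in> \<A>" for A B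
    using crp[OF that(2,1)] by (simp add: Int_commute[of B A])
  have trace: "t \<le> card (A \<inter> {1..p})" "t \<le> card (B \<inter> {1..p})" if "A \<in> \<A>" "B \<in> \<B>" for A B
  proof -
    have "card (A \<inter> B \<inter> {1..p}) \<le> card (A \<inter> {1..p})" "card (A \<inter> B \<inter> {1..p}) \<le> card (B \<inter> {1..p})"
      by (auto intro!: card_mono)
    then show "t \<le> card (A \<inter> {1..p})" "t \<le> card (B \<inter> {1..p})" using crp[OF that] by linarith+
  qed
  obtain A1 B1 where 1: "A1 \<in> \<A>" "B1 \<in> \<B>" using False by blast
  have "t \<le> p"
    using trace(1)[OF 1] card_mono[of "{1..p}" "A1 \<inter> {1..p}"] by simp
  show ?thesis
  proof (cases "p = t")
    case True
    have "{1..t} \<subseteq> A \<and> {1..t} \<subseteq> B" if "A \<in> \<A>" "B \<in> \<B>" for A B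
    proof -
      have "A \<inter> B \<inter> {1..t} = {1..t}"
        by (rule card_seteq) (use crp[OF that] True in auto)
      then show ?thesis by blast
    qed
    then have "\<A> \<subseteq> members_above G {1..t} \<and> \<B> \<subseteq> members_above H {1..t}"
      using sub 1 unfolding members_above_def by blast
    then show ?thesis ..
  next
    case pt: False
    then have "t < p" using \<open>t \<le> p\<close> by simp
    have "\<not> Q (p - 1)" using \<open>t < p\<close> not_less_Least[of "p - 1" Q] by (simp add: p_def)
    then obtain A0 B0 where 0: "A0 \<in> \<A>" "B0 \<in> \<B>" "card (A0 \<inter> B0 \<inter> {1..p - 1}) < t"
      by (auto simp: Q_def not_le)
    have ins: "{1..p} = insert p {1..p - 1}" using \<open>t < p\<close> by auto
    (* The intersection grows when p is added to {1..p - 1}, and it cannot grow by more than one. *)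
    have p0: "p \<in> A0 \<inter> B0"
    proof (rule ccontr)
      assume "p \<notin> A0 \<inter> B0"
      then have "A0 \<inter> B0 \<inter> {1..p} = A0 \<inter> B0 \<inter> {1..p - 1}" unfolding ins by auto
      then show False using crp[OF 0(1,2)] 0(3) by simp
    qed
    then have "A0 \<inter> B0 \<inter> {1..p} = insert p (A0 \<inter> B0 \<inter> {1..p - 1})" unfolding ins by auto
    then have "card (A0 \<inter> B0 \<inter> {1..p}) \<le> Suc (card (A0 \<inter> B0 \<inter> {1..p - 1}))"
      by (simp add: card_insert_le_m1 card_insert_if)
    then have crit: "card (A0 \<inter> B0 \<inter> {1..p}) = t" using crp[OF 0(1,2)] 0(3) by linarith
    define a b where "a = card (A0 \<inter> {1..p})" and "b = card (B0 \<inter> {1..p})"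
    have p0': "p \<in> A0" "p \<in> B0" using p0 by auto
    note cp = critical_pair[OF compr(1) 0(1) p0' \<open>p \<le> n\<close> t crp[OF _ 0(2)] crit]
    have ab: "a + b = p + t" using cp(2) by (simp add: a_def b_def)
    have abt: "t \<le> a" "t \<le> b" using trace[OF 0(1,2)] by (auto simp: a_def b_def)
    have "dominated t c (sum g \<A> * sum h \<B>)
      (sum g (members_above G {1..t}) * sum h (members_above H {1..t}))"
    proof -
      consider "a = t" | "b = t" | "t < a" "t < b" "p = t + 2" | "t < a" "t < b" "t + 3 \<le> p"
        using abt ab by linarith
      then show ?thesis
      proof cases
        case 1
        have "{1..p} \<subseteq> B" if "B \<in> \<B>" for B
          by (rule initial_subset_of_small_trace[OF compr(1) 0(1) p0'(1) _ \<open>p \<le> n\<close> crp[OF _ that]])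
            (use 1 in \<open>simp_all add: a_def\<close>)
        then show ?thesis
          by (intro dominated_full_trace[OF wG wH T \<open>t < p\<close> \<open>p \<le> n\<close> sub(1) trace(1)[OF _ 0(2)] sub(2)])
      next
        case 2
        have "{1..p} \<subseteq> A" if "A \<in> \<A>" for A
          by (rule initial_subset_of_small_trace[OF compr(2) 0(2) p0'(2) _ \<open>p \<le> n\<close> crp'[OF _ that]])
            (use 2 in \<open>simp_all add: b_def\<close>)
        then have "dominated t c (sum h \<B> * sum g \<A>)
            (sum h (members_above H {1..t}) * sum g (members_above G {1..t}))"
          by (intro dominated_full_trace[OF wH wG T(2,1) \<open>t < p\<close> \<open>p \<le> n\<close> sub(2) trace(2)[OF 0(1)] sub(1)])
        then show ?thesis by (simp add: mult.commute)
      next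
        case 3
        (* Both traces have t + 1 of the t + 2 points, and they cover {1..p}, so the missing points
           differ; as neither of them is p, one of them is at most t. *)
        have miss: "\<exists>i\<in>{1..t + 1}. C \<inter> {1..p} = {1..p} - {i}"
          if C: "p \<in> C" "card (C \<inter> {1..p}) = t + 1" for C
        proof -
          have "card ({1..p} - C) = 1"
            using C 3 by (subst card_Diff_subset_Int) (auto simp: Int_commute)
          then obtain i where i: "{1..p} - C = {i}" by (auto simp: card_1_singleton_iff)
          then have "C \<inter> {1..p} = {1..p} - {i}" by blast
          moreover have "i \<in> {1..p}" "i \<noteq> p" using i C by blast+
          then have "i \<in> {1..t + 1}" using 3 by auto
          ultimately show ?thesis by blast
        qed
        have "card (A0 \<inter> {1..p}) = t + 1" "card (B0 \<inter> {1..p}) = t + 1"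
          using 3 ab by (auto simp: a_def b_def)
        then obtain i j where ij: "i \<in> {1..t + 1}" "A0 \<inter> {1..p} = {1..p} - {i}"
          "j \<in> {1..t + 1}" "B0 \<inter> {1..p} = {1..p} - {j}"
          using miss[OF p0'(1)] miss[OF p0'(2)] by blast
        have "i \<in> {1..p}" using ij(1) 3 by auto
        then have "i \<noteq> j" using ij(2,4) cp(1) by blast
        then have "i \<in> {1..t} \<or> j \<in> {1..t}" using ij(1,3) by auto
        then show ?thesis
        proof
          assume i: "i \<in> {1..t}"
          show ?thesis
            by (rule dominated_two_extra_points[OF wG wH T _ sub compr crp[unfolded 3(3)]
                  0(1) ij(2)[unfolded 3(3)] i 0(2) ij(4)[unfolded 3(3)] ij(3)])
              (use 3 \<open>p \<le> n\<close> in simp)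
        next
          assume j: "j \<in> {1..t}"
          have "dominated t c (sum h \<B> * sum g \<A>)
            (sum h (members_above H {1..t}) * sum g (members_above G {1..t}))"
            by (rule dominated_two_extra_points[OF wH wG T(2,1) _ sub(2,1) compr(2,1) crp'[unfolded 3(3)]
                  0(2) ij(4)[unfolded 3(3)] j 0(1) ij(2)[unfolded 3(3)] ij(1)])
              (use 3 \<open>p \<le> n\<close> in simp)
          then show ?thesis by (simp add: mult.commute)
        qed
      next
        case 4
        have False
          by (rule swap_increases[OF wG wH sub compr 4(3) \<open>p \<le> n\<close> crp 0(1) p0'(1) a_def[symmetric] 4(1)
                0(2) p0'(2) b_def[symmetric] 4(2) crit ab opt])
        then show ?thesis ..
      qed
    qed
    then show ?thesis ..
  qed
qed

section \<open>Two arbitrary cross-intersecting families\<close>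

text \<open>Both families have to be shifted together to remain cross-intersecting; one shift that changes
  either of them decreases the joint measure.\<close>

lemma ex_decreasing_shift:
  assumes wG: "weighted_family n t c G g" and wH: "weighted_family n t c H h"
    and sub: "\<A> \<subseteq> G" "\<B> \<subseteq> H" and nc: "\<not> (compressed n \<A> \<and> compressed n \<B>)"
  obtains i j where "i \<in> {1..n}" "j \<in> {1..n}" "i < j"
    "element_sum (shift_family i j \<A>) + element_sum (shift_family i j \<B>)
      < element_sum \<A> + element_sum \<B>"
proof -
  interpret G: weighted_family n t c G g by (rule wG)
  interpret H: weighted_family n t c H h by (rule wH)
  have finA: "A \<in> \<A> \<Longrightarrow> finite A" and finB: "B \<in> \<B> \<Longrightarrow> finite B" for A B
    using sub G.finite_member H.finite_member by auto
  have finf: "finite \<A>" "finite \<B>" using sub G.finite_subfamily H.finite_subfamily by auto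
  have Pow: "\<A> \<subseteq> Pow {1..n}" "\<B> \<subseteq> Pow {1..n}" using sub G.ground H.ground by auto
  show ?thesis
  proof (cases "compressed n \<A>")
    case False
    then obtain i j A where *: "i \<in> {1..n}" "j \<in> {1..n}" "i < j" "A \<in> \<A>" "shift i j A \<notin> \<A>"
      using not_compressedE Pow by metis
    show ?thesis
      using that[OF *(1-3)] element_sum_shift_less[OF *(3) finA finf(1) *(4,5)]
        element_sum_shift_le[OF *(3) finB] by fastforce
  next
    case True
    then have "\<not> compressed n \<B>" using nc by simp
    then obtain i j B where *: "i \<in> {1..n}" "j \<in> {1..n}" "i < j" "B \<in> \<B>" "shift i j B \<notin> \<B>"
      using not_compressedE Pow by metis
    show ?thesis
      using that[OF *(1-3)] element_sum_shift_less[OF *(3) finB finf(2) *(4,5)]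
        element_sum_shift_le[OF *(3) finA] by fastforce
  qed
qed

lemma shift_pair:
  assumes wG: "weighted_family n t c G g" and wH: "weighted_family n t c H h"
    and sub: "\<A> \<subseteq> G" "\<B> \<subseteq> H" and cr: "cross t \<A> \<B>"
    and ij: "i \<in> {1..n}" "j \<in> {1..n}" "i < j"
  shows "shift_family i j \<A> \<subseteq> G" "shift_family i j \<B> \<subseteq> H"
    and "cross t (shift_family i j \<A>) (shift_family i j \<B>)"
    and "sum g \<A> * sum h \<B> \<le> sum g (shift_family i j \<A>) * sum h (shift_family i j \<B>)"
proof -
  interpret G: weighted_family n t c G g by (rule wG)
  interpret H: weighted_family n t c H h by (rule wH)
  show s: "shift_family i j \<A> \<subseteq> G" "shift_family i j \<B> \<subseteq> H"
    using G.shift_family_subset H.shift_family_subset sub ij by auto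
  show "cross t (shift_family i j \<A>) (shift_family i j \<B>)"
    by (rule cross_shift_family[OF cr])
      (use ij sub G.finite_member H.finite_member in auto)
  show "sum g \<A> * sum h \<B> \<le> sum g (shift_family i j \<A>) * sum h (shift_family i j \<B>)"
    by (rule mult_mono[OF G.weight_shift_family[OF sub(1) ij] H.weight_shift_family[OF sub(2) ij]
          G.weight_nonneg[OF s(1)] H.weight_nonneg[OF sub(2)]])
qed

text \<open>Among the pairs with the largest product, one with the smallest element sum is compressed, since
  another shift would not decrease the product.\<close>

lemma cross_pair_bound:
  assumes wG: "weighted_family n t c G g" and wH: "weighted_family n t c H h"
    and T: "{1..t} \<in> G" "{1..t} \<in> H"
    and sub: "\<A> \<subseteq> G" "\<B> \<subseteq> H" and cr: "cross t \<A> \<B>"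
  shows "sum g \<A> * sum h \<B> \<le> sum g (members_above G {1..t}) * sum h (members_above H {1..t})"
proof -
  interpret G: weighted_family n t c G g by (rule wG)
  interpret H: weighted_family n t c H h by (rule wH)
  define X where "X = {(\<A>, \<B>). \<A> \<subseteq> G \<and> \<B> \<subseteq> H \<and> cross t \<A> \<B>}"
  define f where "f = (\<lambda>(\<A>, \<B>). sum g \<A> * sum h \<B>)"
  define s where "s = (\<lambda>(\<A>, \<B>). element_sum \<A> + element_sum \<B>)"
  have mem: "(\<A>, \<B>) \<in> X" using sub cr by (simp add: X_def)
  have "X \<subseteq> Pow G \<times> Pow H" by (auto simp: X_def)
  then have "finite X" using G.finite_H H.finite_H by (auto intro: finite_subset)
  then have "finite (f ` X)" "f ` X \<noteq> {}" using mem by auto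
  then have "Max (f ` X) \<in> f ` X" by (rule Max_in)
  then obtain x0 where "x0 \<in> X \<and> f x0 = Max (f ` X)" by (metis imageE)
  then obtain x where x: "x \<in> X" "f x = Max (f ` X)"
    and min: "\<And>y. y \<in> X \<Longrightarrow> f y = Max (f ` X) \<Longrightarrow> s x \<le> s y"
    using ex_has_least_nat[of "\<lambda>y. y \<in> X \<and> f y = Max (f ` X)" x0 s] by blast
  have max: "f y \<le> f x" if "y \<in> X" for y
    using that x \<open>finite (f ` X)\<close> by simp
  obtain \<C> \<D> where CD: "x = (\<C>, \<D>)" by fastforce
  then have C: "\<C> \<subseteq> G" "\<D> \<subseteq> H" "cross t \<C> \<D>" using x by (auto simp: X_def)
  have compr: "compressed n \<C> \<and> compressed n \<D>"
  proof (rule ccontr)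
    assume "\<not> ?thesis"
    from ex_decreasing_shift[OF wG wH C(1,2) this]
    obtain i j where ij: "i \<in> {1..n}" "j \<in> {1..n}" "i < j"
      and less: "element_sum (shift_family i j \<C>) + element_sum (shift_family i j \<D>)
        < element_sum \<C> + element_sum \<D>" by metis
    let ?y = "(shift_family i j \<C>, shift_family i j \<D>)"
    note sp = shift_pair[OF wG wH C ij]
    have "?y \<in> X" using sp by (simp add: X_def)
    moreover have "f x \<le> f ?y" using sp(4) by (simp add: f_def CD)
    ultimately have "f ?y = Max (f ` X)" using max[of ?y] x by simp
    then have "s x \<le> s ?y" using min \<open>?y \<in> X\<close> by blast
    then show False using less by (simp add: s_def CD)
  qed
  have opt: "sum g \<A>' * sum h \<B>' \<le> sum g \<C> * sum h \<D>"
    if "\<A>' \<subseteq> G" "\<B>' \<subseteq> H" "cross t \<A>' \<B>'" for \<A>' \<B>'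
    using max[of "(\<A>', \<B>')"] that by (simp add: X_def f_def CD)
  have "sum g \<A> * sum h \<B> \<le> sum g \<C> * sum h \<D>" by (rule opt[OF sub cr])
  also have "\<dots> \<le> sum g (members_above G {1..t}) * sum h (members_above H {1..t})"
  proof -
    have "(\<C> \<subseteq> members_above G {1..t} \<and> \<D> \<subseteq> members_above H {1..t}) \<or>
      dominated t c (sum g \<C> * sum h \<D>)
        (sum g (members_above G {1..t}) * sum h (members_above H {1..t}))"
      by (rule compressed_optimum[OF wG wH T C(1,2) conjunct1[OF compr] conjunct2[OF compr] C(3)])
        (rule opt)
    then show ?thesis
    proof (elim disjE conjE)
      assume "\<C> \<subseteq> members_above G {1..t}" "\<D> \<subseteq> members_above H {1..t}"
      then show ?thesis
        by (intro mult_mono G.weight_mono H.weight_mono G.weight_nonneg H.weight_nonneg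
            G.above_subset H.above_subset C)
    qed (simp add: dominated_def)
  qed
  finally show ?thesis .
qed

lemma product_eqD:
  fixes a b x y :: real
  assumes "a \<le> x" "b \<le> y" "0 \<le> a" "0 \<le> b" "0 < x" "0 < y" "x * y \<le> a * b"
  shows "a = x" "b = y"
proof -
  have "a * b \<le> a * y" "a * b \<le> x * b" using assms by (auto intro: mult_left_mono mult_right_mono)
  then have "x * y \<le> a * y" "x * y \<le> x * b" using assms(7) by linarith+
  then show "a = x" "b = y" using assms by auto
qed

text \<open>Each factor is at most the weight above \<open>K\<close>, hence at most the weight above \<open>{1..t}\<close>.  When the
  products agree, all these inequalities are equalities.\<close>

lemma kernel_equality:
  assumes wG: "weighted_family n t c G g" and wH: "weighted_family n t c H h"
    and T: "{1..t} \<in> G" "{1..t} \<in> H"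
    and K: "K \<subseteq> {1..n}" "card K = t"
    and sub: "\<A> \<subseteq> members_above G K" "\<B> \<subseteq> members_above H K"
    and max: "sum g (members_above G {1..t}) * sum h (members_above H {1..t}) \<le> sum g \<A> * sum h \<B>"
  shows "\<A> = members_above G K" "\<B> = members_above H K"
    and "sum g (members_above G K) = sum g (members_above G {1..t})"
    and "sum h (members_above H K) = sum h (members_above H {1..t})"
    and "K \<in> \<A>" "K \<in> \<B>"
proof -
  interpret G: weighted_family n t c G g by (rule wG)
  interpret H: weighted_family n t c H h by (rule wH)
  have posG: "0 < sum g (members_above G {1..t})"
    by (rule G.weight_initial_pos[OF T(1)])
  have posH: "0 < sum h (members_above H {1..t})"
    by (rule H.weight_initial_pos[OF T(2)])
  have G1: "sum g \<A> \<le> sum g (members_above G K)" and H1: "sum h \<B> \<le> sum h (members_above H K)"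
    using G.weight_mono[OF sub(1) G.above_subset] H.weight_mono[OF sub(2) H.above_subset] by auto
  have G2: "sum g (members_above G K) \<le> sum g (members_above G {1..t})"
    and H2: "sum h (members_above H K) \<le> sum h (members_above H {1..t})"
    using G.weight_above_initial[OF K(1)] H.weight_above_initial[OF K(1)] K(2) by auto
  have subGH: "\<A> \<subseteq> G" "\<B> \<subseteq> H" using sub G.above_subset H.above_subset by blast+
  note eq = product_eqD[OF order_trans[OF G1 G2] order_trans[OF H1 H2] G.weight_nonneg[OF subGH(1)]
      H.weight_nonneg[OF subGH(2)] posG posH max]
  show A: "\<A> = members_above G K" by (rule G.weight_eqD[OF sub(1) G.above_subset]) (use eq G2 in simp)
  show B: "\<B> = members_above H K" by (rule H.weight_eqD[OF sub(2) H.above_subset]) (use eq H2 in simp)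
  show "sum g (members_above G K) = sum g (members_above G {1..t})" using eq(1) A by simp
  show "sum h (members_above H K) = sum h (members_above H {1..t})" using eq(2) B by simp
  have "\<A> \<noteq> {}" "\<B> \<noteq> {}" using eq posG posH by auto
  then show "K \<in> \<A>" "K \<in> \<B>"
    unfolding A B members_above_def using G.subset_mem H.subset_mem by blast+
qed

text \<open>If \<open>K\<close> appears after a shift, it was there before or arose from \<open>L = K - {i} \<union> {j}\<close>.  Both families
  must agree on which, as \<open>K\<close> and \<open>L\<close> have only \<open>t - 1\<close> points in common.\<close>

lemma kernel_before_shift:
  assumes cr: "cross t \<A> \<B>" and t: "1 \<le> t" and n: "i \<in> {1..n}" "j \<in> {1..n}"
    and K: "K \<subseteq> {1..n}" "card K = t"
    and mem: "K \<in> shift_family i j \<A>" "K \<in> shift_family i j \<B>"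
  obtains L where "L \<subseteq> {1..n}" "card L = t" "L \<in> \<A>" "L \<in> \<B>"
proof -
  define L where "L = insert j (K - {i})"
  have finK: "finite K" using K finite_subset by blast
  have pre: "C = K \<or> (i \<in> K \<and> j \<notin> K \<and> C = L)" if "K = shift_within i j \<X> C" "i \<noteq> j" for \<X> C
  proof (cases "shift i j C = C \<or> shift i j C \<in> \<X>")
    case False
    then have "j \<in> C" "i \<notin> C" using shift_id by blast+
    moreover have "K = shift i j C" using that False by (simp add: shift_within_def)
    ultimately show ?thesis using \<open>i \<noteq> j\<close> by (auto simp: shift_eq L_def)
  qed (use that in \<open>auto simp: shift_within_def\<close>)
  obtain A B where AB: "A \<in> \<A>" "K = shift_within i j \<A> A" "B \<in> \<B>" "K = shift_within i j \<B> B"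
    using mem by (auto simp: shift_family_def)
  show ?thesis
  proof (cases "i = j")
    case True
    then have "shift_within i j \<X> C = C" for \<X> C by (auto simp: shift_within_def shift_def)
    then show ?thesis using that[OF K] AB by simp
  next
    case False
    note p = pre[OF AB(2) False] pre[OF AB(4) False]
    have sizeL: "card L = t" "L \<subseteq> {1..n}" if "i \<in> K" "j \<notin> K"
      using that K n finK unfolding L_def by (auto simp: card_Suc_Diff1 simp del: card_Diff_insert)
    have "A = B"
    proof (rule ccontr)
      assume "A \<noteq> B"
      then have ij: "i \<in> K" "j \<notin> K" and "{A, B} = {K, L}" using p by auto
      then have "A \<inter> B = K \<inter> L" by (auto simp: doubleton_eq_iff)
      also have "\<dots> = K - {i}" using ij by (auto simp: L_def)
      also have "card \<dots> = t - 1" using ij K by simp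
      finally have "card (A \<inter> B) < t" using t by simp
      moreover have "t \<le> card (A \<inter> B)" using cr AB(1,3) by (simp add: cross_def)
      ultimately show False by simp
    qed
    then show ?thesis using p that[OF K] that[OF sizeL(2,1)] AB by auto
  qed
qed

text \<open>Induction along decreasing shifts.  The shifted pair is still optimal and hence consists of all
  members above some \<open>K\<close>, in particular it contains \<open>K\<close>; so the original families share a \<open>t\<close>-set
  \<open>L\<close>, and a \<open>t\<close>-set in one family lies inside every member of the other.\<close>

lemma cross_pair_equality:
  assumes wG: "weighted_family n t c G g" and wH: "weighted_family n t c H h"
    and T: "{1..t} \<in> G" "{1..t} \<in> H" and c: "real t < c"
    and "\<A> \<subseteq> G" "\<B> \<subseteq> H" "cross t \<A> \<B>"
    and "sum g (members_above G {1..t}) * sum h (members_above H {1..t}) \<le> sum g \<A> * sum h \<B>"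
  shows "\<exists>K. K \<subseteq> {1..n} \<and> card K = t \<and> \<A> \<subseteq> members_above G K \<and> \<B> \<subseteq> members_above H K"
  using assms(6-9)
proof (induction "element_sum \<A> + element_sum \<B>" arbitrary: \<A> \<B> rule: less_induct)
  case less
  interpret G: weighted_family n t c G g by (rule wG)
  interpret H: weighted_family n t c H h by (rule wH)
  note sub = less.prems(1,2) and cr = less.prems(3) and ge = less.prems(4)
  show ?case
  proof (cases "compressed n \<A> \<and> compressed n \<B>")
    case True
    have opt: "sum g \<A>' * sum h \<B>' \<le> sum g \<A> * sum h \<B>"
      if "\<A>' \<subseteq> G" "\<B>' \<subseteq> H" "cross t \<A>' \<B>'" for \<A>' \<B>'
      using cross_pair_bound[OF wG wH T that] ge by linarith
    have "\<not> dominated t c (sum g \<A> * sum h \<B>)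
        (sum g (members_above G {1..t}) * sum h (members_above H {1..t}))"
      using ge c by (simp add: dominated_def)
    moreover have "(\<A> \<subseteq> members_above G {1..t} \<and> \<B> \<subseteq> members_above H {1..t}) \<or>
      dominated t c (sum g \<A> * sum h \<B>)
        (sum g (members_above G {1..t}) * sum h (members_above H {1..t}))"
      by (rule compressed_optimum[OF wG wH T sub conjunct1[OF True] conjunct2[OF True] cr])
        (rule opt)
    ultimately have "\<A> \<subseteq> members_above G {1..t} \<and> \<B> \<subseteq> members_above H {1..t}" by simp
    moreover have "{1..t} \<subseteq> {1..n}" using T(1) G.ground by blast
    ultimately show ?thesis by (intro exI[of _ "{1..t}"] conjI) simp_all
  next
    case False
    from ex_decreasing_shift[OF wG wH sub False]
    obtain i j where ij: "i \<in> {1..n}" "j \<in> {1..n}" "i < j"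
      and dec: "element_sum (shift_family i j \<A>) + element_sum (shift_family i j \<B>)
        < element_sum \<A> + element_sum \<B>" by metis
    note sp = shift_pair[OF wG wH sub cr ij]
    have ge': "sum g (members_above G {1..t}) * sum h (members_above H {1..t})
        \<le> sum g (shift_family i j \<A>) * sum h (shift_family i j \<B>)"
      using ge sp(4) by linarith
    obtain K where K: "K \<subseteq> {1..n}" "card K = t" "shift_family i j \<A> \<subseteq> members_above G K"
      "shift_family i j \<B> \<subseteq> members_above H K"
      using less.hyps[OF dec sp(1-3) ge'] by blast
    note ke = kernel_equality[OF wG wH T K ge']
    obtain L where L: "L \<subseteq> {1..n}" "card L = t" "L \<in> \<A>" "L \<in> \<B>"
      by (rule kernel_before_shift[OF cr G.t_pos ij(1,2) K(1,2) ke(5,6)])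
    have finL: "finite L" using L finite_subset by blast
    have absorb: "L \<subseteq> C" if "t \<le> card (C \<inter> L)" for C
    proof -
      have "C \<inter> L = L" by (rule card_seteq) (use finL that L in auto)
      then show ?thesis by blast
    qed
    have "L \<subseteq> A" if "A \<in> \<A>" for A
      by (rule absorb) (use cr that L(4) in \<open>simp add: cross_def\<close>)
    moreover have "L \<subseteq> B" if "B \<in> \<B>" for B
      by (rule absorb, subst Int_commute) (use cr that L(3) in \<open>simp add: cross_def\<close>)
    ultimately have "\<A> \<subseteq> members_above G L" "\<B> \<subseteq> members_above H L"
      using sub unfolding members_above_def by blast+
    then show ?thesis by (intro exI[of _ L] conjI L)
  qed
qed

section \<open>From two families to many\<close>

lemma sum_pairs:
  fixes s :: "'a \<Rightarrow> real"
  assumes "finite I" "2 \<le> card I"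
  shows "(\<Sum>i\<in>I. \<Sum>j\<in>I - {i}. s i + s j) = 2 * (real (card I) - 1) * sum s I"
proof -
  have "(\<Sum>j\<in>I - {i}. s i + s j) = (real (card I) - 2) * s i + sum s I" if "i \<in> I" for i
  proof -
    have "sum s (I - {i}) = sum s I - s i" using assms(1) that by (simp add: sum_diff1)
    moreover have "real (card (I - {i})) = real (card I) - 1"
      using assms that by (simp add: of_nat_diff)
    moreover have "(\<Sum>j\<in>I - {i}. s i + s j) = real (card (I - {i})) * s i + sum s (I - {i})"
      by (simp add: sum.distrib)
    ultimately have "(\<Sum>j\<in>I - {i}. s i + s j) = (real (card I) - 1) * s i + (sum s I - s i)"
      by (simp only:)
    then show ?thesis by (simp add: algebra_simps)
  qed
  then have "(\<Sum>i\<in>I. \<Sum>j\<in>I - {i}. s i + s j) = (\<Sum>i\<in>I. (real (card I) - 2) * s i + sum s I)"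
    by (rule sum.cong[OF refl])
  also have "\<dots> = (real (card I) - 2) * sum s I + real (card I) * sum s I"
    by (simp add: sum.distrib sum_distrib_left)
  finally show ?thesis by (simp add: algebra_simps)
qed

text \<open>The logarithms of the ratios \<open>P i / M i\<close> have non-positive sums over pairs, and the sum over all
  ordered pairs is a positive multiple of the total.\<close>

lemma prod_le_if_pairwise_le:
  fixes P M :: "'a \<Rightarrow> real"
  assumes I: "finite I" "2 \<le> card I"
    and nonneg: "\<And>i. i \<in> I \<Longrightarrow> 0 \<le> P i" "\<And>i. i \<in> I \<Longrightarrow> 0 \<le> M i"
    and le: "\<And>i j. i \<in> I \<Longrightarrow> j \<in> I \<Longrightarrow> i \<noteq> j \<Longrightarrow> P i * P j \<le> M i * M j"
  shows "prod P I \<le> prod M I"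
    and "prod P I = prod M I \<Longrightarrow> (\<And>i. i \<in> I \<Longrightarrow> 0 < M i) \<Longrightarrow> i \<in> I \<Longrightarrow> j \<in> I \<Longrightarrow> i \<noteq> j \<Longrightarrow>
      P i * P j = M i * M j"
proof -
  define s where "s i = ln (P i) - ln (M i)" for i
  have log: "s i + s j \<le> 0 \<and> (s i + s j = 0 \<longrightarrow> P i * P j = M i * M j)"
    if pos: "\<And>i. i \<in> I \<Longrightarrow> 0 < P i" "\<And>i. i \<in> I \<Longrightarrow> 0 < M i" and ij: "i \<in> I" "j \<in> I" "i \<noteq> j" for i j
  proof -
    have p: "0 < P i" "0 < P j" "0 < M i" "0 < M j" using pos ij by auto
    have e: "s i + s j = ln (P i * P j) - ln (M i * M j)" using p by (simp add: s_def ln_mult)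
    have "ln (P i * P j) \<le> ln (M i * M j)" using le[OF ij] p by simp
    moreover have "ln (P i * P j) = ln (M i * M j) \<Longrightarrow> P i * P j = M i * M j"
      using p by (metis ln_inj_iff mult_pos_pos)
    ultimately show ?thesis using e by auto
  qed
  have prods: "ln (prod P I) - ln (prod M I) = sum s I"
    if pos: "\<And>i. i \<in> I \<Longrightarrow> 0 < P i" "\<And>i. i \<in> I \<Longrightarrow> 0 < M i"
  proof -
    have "P i \<noteq> 0" "M i \<noteq> 0" if "i \<in> I" for i using pos[OF that] by auto
    then show ?thesis using ln_prod[OF I(1)] by (simp add: s_def sum_subtractf)
  qed
  show "prod P I \<le> prod M I"
  proof (cases "\<exists>i\<in>I. P i = 0")
    case True
    then have "prod P I = 0" using I(1) by auto
    then show ?thesis using nonneg(2) by (simp add: prod_nonneg)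
  next
    case False
    then have posP: "0 < P i" if "i \<in> I" for i using nonneg(1)[OF that] that by (metis less_le)
    have posM: "0 < M i" if i: "i \<in> I" for i
    proof -
      have "I \<noteq> {i}" using I(2) by auto
      then obtain j where j: "j \<in> I" "i \<noteq> j" using i by blast
      then have "0 < M i * M j" using le[OF i j] posP[OF i] posP[OF j(1)]
        by (meson less_le_trans mult_pos_pos)
      then show ?thesis using nonneg(2)[OF i] by (metis less_le mult_eq_0_iff)
    qed
    have "2 * (real (card I) - 1) * sum s I \<le> 0"
      unfolding sum_pairs[OF I, symmetric] using log[OF posP posM] by (intro sum_nonpos) auto
    then have "sum s I \<le> 0" using I(2) by (simp add: mult_le_0_iff)
    then have "ln (prod P I) \<le> ln (prod M I)" using prods[OF posP posM] by simp
    moreover have "0 < prod P I" "0 < prod M I" using posP posM by (auto intro: prod_pos)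
    ultimately show ?thesis by simp
  qed
  assume eq: "prod P I = prod M I" and posM: "\<And>i. i \<in> I \<Longrightarrow> 0 < M i" and ij: "i \<in> I" "j \<in> I" "i \<noteq> j"
  have "0 < prod P I" unfolding eq using posM by (auto intro: prod_pos)
  then have posP: "0 < P i" if "i \<in> I" for i
    using nonneg(1)[OF that] I(1) that by (metis less_le prod_zero_iff)
  have "sum s I = 0" using prods[OF posP posM] eq by simp
  then have "(\<Sum>i\<in>I. \<Sum>j\<in>I - {i}. - (s i + s j)) = 0"
    using sum_pairs[OF I, of s] by (simp only: sum_negf)
  moreover have "0 \<le> (\<Sum>j\<in>I - {i}. - (s i + s j))" if "i \<in> I" for i
  proof (rule sum_nonneg)
    fix j assume "j \<in> I - {i}"
    then have "s i + s j \<le> 0" using log[OF posP posM that, of j] by blast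
    then show "0 \<le> - (s i + s j)" by linarith
  qed
  ultimately have "(\<Sum>j\<in>I - {i}. - (s i + s j)) = 0"
    using sum_nonneg_eq_0_iff[OF I(1), of "\<lambda>i. \<Sum>j\<in>I - {i}. - (s i + s j)"] ij(1) by blast
  moreover have "0 \<le> - (s i + s k)" if "k \<in> I - {i}" for k
    using log[OF posP posM ij(1), of k] that by auto
  ultimately have "- (s i + s j) = 0"
    using sum_nonneg_eq_0_iff[of "I - {i}" "\<lambda>j. - (s i + s j)"] I(1) ij by blast
  then show "P i * P j = M i * M j" using log[OF posP posM ij] by simp
qed

theorem theorem2p2:
  fixes k n t :: nat and u :: real
    and H :: "nat \<Rightarrow> nat set set"
    and w :: "nat \<Rightarrow> nat set \<Rightarrow> real"
    and \<A> :: "nat \<Rightarrow> nat set set"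
  assumes "k \<ge> 2" and "1 \<le> t" and "t \<le> n"
    and "u \<ge> 0" and "u > (6 - real t) / 3"
    and "\<And>l. l \<in> {1..k} \<Longrightarrow>
           H l \<noteq> {} \<and> H l \<subseteq> Pow {1..n} \<and> compressed n (H l) \<and> hereditary (H l)"
    and "\<And>l A. l \<in> {1..k} \<Longrightarrow> A \<in> H l \<Longrightarrow> w l A > 0"
    and "\<And>l A B. l \<in> {1..k} \<Longrightarrow> A \<in> H l \<Longrightarrow> B \<in> H l \<Longrightarrow> A \<subset> B \<Longrightarrow> t \<le> card A \<Longrightarrow>
           w l A \<ge> (real t + u) * w l B"
    and "\<And>l C i j. l \<in> {1..k} \<Longrightarrow> C \<in> H l \<Longrightarrow> i \<in> {1..n} \<Longrightarrow> j \<in> {1..n} \<Longrightarrow> i < j \<Longrightarrow>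
           w l (shift i j C) \<ge> w l C"
    and "\<And>l. l \<in> {1..k} \<Longrightarrow> \<A> l \<subseteq> H l"
    and "cross_t_intersecting t k \<A>"
  shows "(\<Prod>l\<in>{1..k}. sum (w l) (\<A> l)) \<le> (\<Prod>l\<in>{1..k}. sum (w l) (members_above (H l) {1..t}))
    \<and> (u > 0 \<and> (\<forall>l\<in>{1..k}. \<exists>A\<in>H l. t \<le> card A) \<longrightarrow>
        ((\<Prod>l\<in>{1..k}. sum (w l) (\<A> l)) = (\<Prod>l\<in>{1..k}. sum (w l) (members_above (H l) {1..t}))
         \<longleftrightarrow> (\<exists>T'. T' \<subseteq> {1..n} \<and> card T' = t
               \<and> (\<forall>l\<in>{1..k}. sum (w l) (members_above (H l) T') = sum (w l) (members_above (H l) {1..t}))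
               \<and> (\<forall>l\<in>{1..k}. \<A> l = members_above (H l) T'))))"
proof -
  define c where "c = real t + u"
  have W: "weighted_family n t c (H l) (w l)" if l: "l \<in> {1..k}" for l
  proof
    show "1 \<le> t" by fact
    show "H l \<subseteq> Pow {1..n}" "compressed n (H l)" "hereditary (H l)" using assms(6)[OF l] by auto
    show "\<And>A. A \<in> H l \<Longrightarrow> 0 < w l A" by (rule assms(7)[OF l])
    show "\<And>A B. A \<in> H l \<Longrightarrow> B \<in> H l \<Longrightarrow> A \<subset> B \<Longrightarrow> t \<le> card A \<Longrightarrow> c * w l B \<le> w l A"
      unfolding c_def by (rule assms(8)[OF l])
    show "\<And>C i j. C \<in> H l \<Longrightarrow> i \<in> {1..n} \<Longrightarrow> j \<in> {1..n} \<Longrightarrow> i < j \<Longrightarrow> w l C \<le> w l (shift i j C)"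
      by (rule assms(9)[OF l])
    show "real t \<le> c" using assms(4) by (simp add: c_def)
    show "2 + 2 * real t / 3 < c" using assms(5) by (simp add: c_def field_simps)
  qed
  define P where "P l = sum (w l) (\<A> l)" for l
  define M where "M l = sum (w l) (members_above (H l) {1..t})" for l
  have P0: "0 \<le> P l" and M0: "0 \<le> M l" if l: "l \<in> {1..k}" for l
    unfolding P_def M_def
    by (rule weighted_family.weight_nonneg[OF W[OF l] assms(10)[OF l]],
        rule weighted_family.weight_nonneg[OF W[OF l] weighted_family.above_subset[OF W[OF l]]])
  have cr: "cross t (\<A> i) (\<A> j)" if "i \<in> {1..k}" "j \<in> {1..k}" "i \<noteq> j" for i j
    using assms(11) that by (simp add: cross_t_intersecting_def cross_def)
  have le: "P i * P j \<le> M i * M j" if i: "i \<in> {1..k}" and j: "j \<in> {1..k}" and ij: "i \<noteq> j" for i j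
  proof (cases "\<A> i = {} \<or> \<A> j = {}")
    case True
    then have "P i * P j = 0" by (auto simp: P_def)
    then show ?thesis by (rule ord_eq_le_trans) (intro mult_nonneg_nonneg M0 i j)
  next
    case False
    then obtain A B where AB: "A \<in> \<A> i" "B \<in> \<A> j" by blast
    (* Members that meet in t points have t points, so the initial segment is in both families. *)
    then have t: "t \<le> card (A \<inter> B)" using cr[OF i j ij] by (simp add: cross_def)
    have H: "A \<in> H i" "B \<in> H j" using AB assms(10) i j by auto
    have "finite A" "finite B"
      by (rule weighted_family.finite_member[OF W[OF i] H(1)],
          rule weighted_family.finite_member[OF W[OF j] H(2)])
    then have "t \<le> card A" "t \<le> card B"
      using t card_mono[of A "A \<inter> B"] card_mono[of B "A \<inter> B"] by auto
    then have "{1..t} \<in> H i" "{1..t} \<in> H j"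
      using weighted_family.initial_mem[OF W[OF i] H(1)] weighted_family.initial_mem[OF W[OF j] H(2)]
      by blast+
    then show ?thesis
      unfolding P_def M_def
      by (rule cross_pair_bound[OF W[OF i] W[OF j] _ _ assms(10)[OF i] assms(10)[OF j] cr[OF i j ij]])
  qed
  have card: "2 \<le> card {1..k}" using assms(1) by simp
  have bound: "prod P {1..k} \<le> prod M {1..k}"
    by (rule prod_le_if_pairwise_le(1)[OF _ card P0 M0 le]) auto
  have equality: "(prod P {1..k} = prod M {1..k}) \<longleftrightarrow> (\<exists>T'. T' \<subseteq> {1..n} \<and> card T' = t
               \<and> (\<forall>l\<in>{1..k}. sum (w l) (members_above (H l) T') = M l)
               \<and> (\<forall>l\<in>{1..k}. \<A> l = members_above (H l) T'))"
    if u: "u > 0" and large: "\<forall>l\<in>{1..k}. \<exists>A\<in>H l. t \<le> card A"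
  proof
    have ct: "real t < c" using u by (simp add: c_def)
    have T: "{1..t} \<in> H l" if "l \<in> {1..k}" for l
      using weighted_family.initial_mem[OF W[OF that]] large that by blast
    have Mpos: "0 < M l" if l: "l \<in> {1..k}" for l
      unfolding M_def
      by (rule weighted_family.weight_initial_pos[OF W[OF l] T[OF l]])
    assume eq: "prod P {1..k} = prod M {1..k}"
    have pair: "\<exists>K. K \<subseteq> {1..n} \<and> card K = t \<and> \<A> i = members_above (H i) K \<and> \<A> j = members_above (H j) K
        \<and> sum (w i) (members_above (H i) K) = M i \<and> sum (w j) (members_above (H j) K) = M j \<and> K \<in> \<A> i"
      if i: "i \<in> {1..k}" and j: "j \<in> {1..k}" and ij: "i \<noteq> j" for i j
    proof -
      have "P i * P j = M i * M j"
        by (rule prod_le_if_pairwise_le(2)[OF _ card P0 M0 le eq Mpos i j ij]) auto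
      then have ge: "M i * M j \<le> P i * P j" by simp
      obtain K where K: "K \<subseteq> {1..n}" "card K = t" "\<A> i \<subseteq> members_above (H i) K"
        "\<A> j \<subseteq> members_above (H j) K"
        using cross_pair_equality[OF W[OF i] W[OF j] T[OF i] T[OF j] ct assms(10)[OF i]
            assms(10)[OF j] cr[OF i j ij] ge[unfolded P_def M_def]] by blast
      note ke = kernel_equality[OF W[OF i] W[OF j] T[OF i] T[OF j] K ge[unfolded P_def M_def]]
      show ?thesis
        unfolding M_def using K(1,2) ke by - (intro exI[of _ K] conjI; assumption)
    qed
    have 1: "1 \<in> {1..k}" "2 \<in> {1..k}" "(1::nat) \<noteq> 2" using assms(1) by auto
    obtain K where K: "K \<subseteq> {1..n}" "card K = t" "\<A> 1 = members_above (H 1) K" "K \<in> \<A> 1"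
      "sum (w 1) (members_above (H 1) K) = M 1"
      using pair[OF 1] by (elim exE conjE) (rule that; assumption)
    have "\<A> l = members_above (H l) K \<and> sum (w l) (members_above (H l) K) = M l" if l: "l \<in> {1..k}" for l
    proof (cases "l = 1")
      case False
      then have "1 \<noteq> l" by simp
      obtain L where L: "\<A> 1 = members_above (H 1) L" "\<A> l = members_above (H l) L"
        "sum (w l) (members_above (H l) L) = M l" "L \<in> \<A> 1"
        using pair[OF 1(1) l \<open>1 \<noteq> l\<close>] by (elim exE conjE) (rule that; assumption)
      (* A kernel that is itself a member is the least member, so all pairs share it. *)
      have "L = K"
      proof (rule antisym)
        have "K \<in> members_above (H 1) L" using K(4) L(1) by simp
        then show "L \<subseteq> K" by (simp add: members_above_def)
        have "L \<in> members_above (H 1) K" using K(3) L(4) by simp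
        then show "K \<subseteq> L" by (simp add: members_above_def)
      qed
      then show ?thesis using L(2,3) by simp
    next
      case True
      show ?thesis unfolding True using K(3,5) by (rule conjI)
    qed
    then show "\<exists>T'. T' \<subseteq> {1..n} \<and> card T' = t
               \<and> (\<forall>l\<in>{1..k}. sum (w l) (members_above (H l) T') = M l)
               \<and> (\<forall>l\<in>{1..k}. \<A> l = members_above (H l) T')"
      using K(1,2) by blast
  next
    assume "\<exists>T'. T' \<subseteq> {1..n} \<and> card T' = t
               \<and> (\<forall>l\<in>{1..k}. sum (w l) (members_above (H l) T') = M l)
               \<and> (\<forall>l\<in>{1..k}. \<A> l = members_above (H l) T')"
    then have "\<And>l. l \<in> {1..k} \<Longrightarrow> P l = M l" by (auto simp: P_def)
    then show "prod P {1..k} = prod M {1..k}" by (rule prod.cong[OF refl])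
  qed
  have products: "(\<Prod>l\<in>{1..k}. sum (w l) (\<A> l)) = prod P {1..k}"
    "(\<Prod>l\<in>{1..k}. sum (w l) (members_above (H l) {1..t})) = prod M {1..k}"
    by (simp_all add: P_def M_def)
  show ?thesis
    unfolding products M_def[symmetric]
  proof (rule conjI[OF bound], rule impI)
    assume "u > 0 \<and> (\<forall>l\<in>{1..k}. \<exists>A\<in>H l. t \<le> card A)"
    then show "(prod P {1..k} = prod M {1..k}) \<longleftrightarrow> (\<exists>T'. T' \<subseteq> {1..n} \<and> card T' = t
               \<and> (\<forall>l\<in>{1..k}. sum (w l) (members_above (H l) T') = M l)
               \<and> (\<forall>l\<in>{1..k}. \<A> l = members_above (H l) T'))"
      by (elim conjE) (rule equality)
  qed
qed

end
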